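(* Let $W=W(H_4)$ be the Coxeter group of type $H_4$ with longest element $w_o$ (which is central and acts as $-1$ in the reflection representation). The involutions in $W$ form exactly five conjugacy classes, namely the pairwise distinct classes $[w_\emptyset]$, $[w_{\{1,2,3,4\}}]$, $[w_{\{1\}}]=[w_{\{2\}}]$, $[w_{\{1,2,3\}}]$, $[w_{\{1,3\}}]=[w_{\{1,4\}}]$. Multiplication by $w_o=-1$ acts on these classes as follows: (1) it interchanges $[w_\emptyset]$ and $[w_{\{1,2,3,4\}}]$; (2) it interchanges $[w_{\{1\}}]$ and $[w_{\{1,2,3\}}]$; (3) it fixes $[w_{\{1,3\}}]$.
   Context: The Coxeter graph $H_4$ is the path with nodes $1,2,3,4$, in which the edge between $1$ and $2$ has label $5$ and the other two edges have label $3$. Node $i$ corresponds to the simple generator $s_i$. For a set of nodes $I$, $W_I$ denotes the parabolic subgroup generated by $\{s_i: i\in I\}$, and $w_I$ denotes its longest element ($w_\emptyset=1$). An involution is an element $x$ with $x^2=1$ (the identity is included); $[x]$ denotes the conjugacy class of $x$ in $W$. *)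

theory Defs
  imports "HOL-Analysis.Analysis" "HOL-Algebra.Generated_Groups"
begin

section \<open>Coxeter groups by generators and relations\<close>

text \<open>The simple generators are indexed by a type \<open>'s\<close>; an entry \<open>m s t = 0\<close> of a Coxeter
  matrix stands for \<open>\<infinity>\<close>, i.e. no relation between \<open>s\<close> and \<open>t\<close>.\<close>

definition coxeter_matrix :: "('s \<Rightarrow> 's \<Rightarrow> nat) \<Rightarrow> bool" where
  "coxeter_matrix m \<longleftrightarrow>
     (\<forall>s. m s s = 1) \<and> (\<forall>s t. m s t = m t s) \<and> (\<forall>s t. s \<noteq> t \<longrightarrow> m s t \<noteq> 1)"

text \<open>The congruence on the free monoid of words generated by \<open>(s t)\<^bsup>m(s,t)\<^esup> = 1\<close>. The case
  \<open>s = t\<close> gives \<open>s s = 1\<close>, so formal inverses of the generators are not needed and the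
  quotient monoid is the group with this presentation.\<close>

inductive coxeter_cong :: "('s \<Rightarrow> 's \<Rightarrow> nat) \<Rightarrow> 's list \<Rightarrow> 's list \<Rightarrow> bool"
  for m :: "'s \<Rightarrow> 's \<Rightarrow> nat" where
  relator: "coxeter_cong m (concat (replicate (m s t) [s, t])) []"
| refl: "coxeter_cong m u u"
| sym: "coxeter_cong m u v \<Longrightarrow> coxeter_cong m v u"
| trans: "coxeter_cong m u v \<Longrightarrow> coxeter_cong m v w \<Longrightarrow> coxeter_cong m u w"
| append: "coxeter_cong m u u' \<Longrightarrow> coxeter_cong m v v' \<Longrightarrow> coxeter_cong m (u @ v) (u' @ v')"

definition coxeter_elt :: "('s \<Rightarrow> 's \<Rightarrow> nat) \<Rightarrow> 's list \<Rightarrow> 's list set" where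
  "coxeter_elt m u = {v. coxeter_cong m u v}"

definition coxeter_group :: "('s \<Rightarrow> 's \<Rightarrow> nat) \<Rightarrow> 's list set monoid" where
  "coxeter_group m =
     \<lparr>carrier = range (coxeter_elt m),
      mult = (\<lambda>X Y. {w. \<exists>u\<in>X. \<exists>v\<in>Y. coxeter_cong m (u @ v) w}),
      one = coxeter_elt m []\<rparr>"

lemma coxeter_elt_eq_iff: "coxeter_elt m u = coxeter_elt m v \<longleftrightarrow> coxeter_cong m u v"
  unfolding coxeter_elt_def
  by (auto intro: coxeter_cong.refl coxeter_cong.sym coxeter_cong.trans)

lemma coxeter_mult_elt:
  "coxeter_elt m u \<otimes>\<^bsub>coxeter_group m\<^esub> coxeter_elt m v = coxeter_elt m (u @ v)"
  unfolding coxeter_group_def coxeter_elt_def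
  by (auto intro: coxeter_cong.refl coxeter_cong.sym coxeter_cong.trans coxeter_cong.append)

lemma coxeter_cong_rev_append:
  assumes "coxeter_matrix m"
  shows "coxeter_cong m (rev u @ u) []"
proof (induction u)
  case Nil
  show ?case by (simp add: coxeter_cong.refl)
next
  case (Cons s u)
  have "coxeter_cong m [s, s] []"
    using coxeter_cong.relator[of m s s] assms by (simp add: coxeter_matrix_def)
  then have "coxeter_cong m (rev u @ [s, s] @ u) (rev u @ [] @ u)"
    by (intro coxeter_cong.append coxeter_cong.refl)
  with Cons.IH show ?case by (auto intro: coxeter_cong.trans)
qed

lemma group_coxeter_group:
  assumes "coxeter_matrix m"
  shows "group (coxeter_group m)"
proof (rule groupI)
  have car: "carrier (coxeter_group m) = range (coxeter_elt m)"
    and one: "\<one>\<^bsub>coxeter_group m\<^esub> = coxeter_elt m []"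
    by (simp_all add: coxeter_group_def)
  show "\<one>\<^bsub>coxeter_group m\<^esub> \<in> carrier (coxeter_group m)"
    by (simp add: car one)
  fix x assume "x \<in> carrier (coxeter_group m)"
  then obtain u where u: "x = coxeter_elt m u" by (auto simp: car)
  show "\<one>\<^bsub>coxeter_group m\<^esub> \<otimes>\<^bsub>coxeter_group m\<^esub> x = x"
    by (simp add: u one coxeter_mult_elt)
  have "coxeter_elt m (rev u) \<otimes>\<^bsub>coxeter_group m\<^esub> x = \<one>\<^bsub>coxeter_group m\<^esub>"
    using coxeter_cong_rev_append[OF assms, of u]
    by (simp add: u one coxeter_mult_elt coxeter_elt_eq_iff)
  then show "\<exists>y\<in>carrier (coxeter_group m).
      y \<otimes>\<^bsub>coxeter_group m\<^esub> x = \<one>\<^bsub>coxeter_group m\<^esub>"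
    by (auto simp: car)
  fix y assume "y \<in> carrier (coxeter_group m)"
  then obtain v where v: "y = coxeter_elt m v" by (auto simp: car)
  show "x \<otimes>\<^bsub>coxeter_group m\<^esub> y \<in> carrier (coxeter_group m)"
    by (simp add: u v car coxeter_mult_elt)
  fix z assume "z \<in> carrier (coxeter_group m)"
  then obtain w where w: "z = coxeter_elt m w" by (auto simp: car)
  show "x \<otimes>\<^bsub>coxeter_group m\<^esub> y \<otimes>\<^bsub>coxeter_group m\<^esub> z
      = x \<otimes>\<^bsub>coxeter_group m\<^esub> (y \<otimes>\<^bsub>coxeter_group m\<^esub> z)"
    by (simp add: u v w coxeter_mult_elt)
qed

section \<open>Length, parabolic subgroups and longest elements\<close>

definition simple_gen :: "('s \<Rightarrow> 's \<Rightarrow> nat) \<Rightarrow> 's \<Rightarrow> 's list set" where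
  "simple_gen m s = coxeter_elt m [s]"

text \<open>An element of the group is the set of all words representing it.\<close>

definition coxeter_length :: "'s list set \<Rightarrow> nat" where
  "coxeter_length w = (LEAST n. \<exists>u\<in>w. length u = n)"

definition parabolic :: "('s \<Rightarrow> 's \<Rightarrow> nat) \<Rightarrow> 's set \<Rightarrow> 's list set set" where
  "parabolic m I = generate (coxeter_group m) (simple_gen m ` I)"

definition longest_elt :: "('s \<Rightarrow> 's \<Rightarrow> nat) \<Rightarrow> 's set \<Rightarrow> 's list set" where
  "longest_elt m I =
     (THE w. w \<in> parabolic m I \<and> (\<forall>v\<in>parabolic m I. coxeter_length v \<le> coxeter_length w))"

section \<open>The reflection representation\<close>

text \<open>The vector \<open>axis s 1\<close> plays the role of the simple root of \<open>s\<close>. For \<open>m s t = 0\<close>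
  (that is, \<open>\<infinity>\<close>) the convention \<open>x / 0 = 0\<close> yields the usual value \<open>-1\<close>.\<close>

definition coxeter_form :: "('s::finite \<Rightarrow> 's \<Rightarrow> nat) \<Rightarrow> real ^ 's \<Rightarrow> real ^ 's \<Rightarrow> real" where
  "coxeter_form m x y = (\<Sum>s\<in>UNIV. \<Sum>t\<in>UNIV. x $ s * y $ t * (- cos (pi / real (m s t))))"

definition simple_reflection :: "('s::finite \<Rightarrow> 's \<Rightarrow> nat) \<Rightarrow> 's \<Rightarrow> real ^ 's \<Rightarrow> real ^ 's" where
  "simple_reflection m s x = x - (2 * coxeter_form m (axis s 1) x) *\<^sub>R axis s 1"

text \<open>All words representing the same element act in the same way, so the image below is a
  singleton.\<close>

definition reflection_rep ::
    "('s::finite \<Rightarrow> 's \<Rightarrow> nat) \<Rightarrow> 's list set \<Rightarrow> real ^ 's \<Rightarrow> real ^ 's" where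
  "reflection_rep m w = the_elem ((\<lambda>u. foldr (simple_reflection m) u) ` w)"

section \<open>Involutions and conjugacy classes\<close>

definition involutions :: "('a, 'b) monoid_scheme \<Rightarrow> 'a set" where
  "involutions G = {x \<in> carrier G. x \<otimes>\<^bsub>G\<^esub> x = \<one>\<^bsub>G\<^esub>}"

definition conj_class :: "('a, 'b) monoid_scheme \<Rightarrow> 'a \<Rightarrow> 'a set" where
  "conj_class G x = {g \<otimes>\<^bsub>G\<^esub> x \<otimes>\<^bsub>G\<^esub> inv\<^bsub>G\<^esub> g | g. g \<in> carrier G}"

section \<open>The group of type \<open>H\<^sub>4\<close>\<close>

text \<open>The nodes are the elements \<open>1, 2, 3, 4\<close> of the four-element numeral type \<open>4\<close>
  (arithmetic there is modulo 4, so \<open>4\<close> is also written \<open>0\<close>).\<close>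

definition H4_matrix :: "4 \<Rightarrow> 4 \<Rightarrow> nat" where
  "H4_matrix i j =
     (if i = j then 1
      else if {i, j} = {1, 2} then 5
      else if {i, j} = {2, 3} \<or> {i, j} = {3, 4} then 3
      else 2)"

abbreviation W_H4 :: "4 list set monoid" where
  "W_H4 \<equiv> coxeter_group H4_matrix"

abbreviation w_H4 :: "4 set \<Rightarrow> 4 list set" where
  "w_H4 \<equiv> longest_elt H4_matrix"

abbreviation cl_H4 :: "4 list set \<Rightarrow> 4 list set set" where
  "cl_H4 \<equiv> conj_class W_H4"

lemma coxeter_matrix_H4: "coxeter_matrix H4_matrix"
  by (auto simp: coxeter_matrix_def H4_matrix_def insert_commute)

lemma group_W_H4: "group W_H4"
  by (rule group_coxeter_group[OF coxeter_matrix_H4])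

end

(* Every involution of a Coxeter group is conjugate to an element w of some parabolic subgroup W_I
   that acts as -1 on the span of the simple roots in I (Richardson); such a w is the longest
   element of W_I. This follows from the fact that len (w s) > len w exactly when w maps the simple
   root of s to a nonnegative combination of simple roots, which also makes the reflection
   representation faithful. On w the reflection representation has trace n - 2 |I|.
   In H4 the trace separates the conjugacy classes of involutions. For |I| = 1 all simple
   reflections are conjugate along odd bonds. For |I| = 2 the two nodes commute, because in a dihedral
   group of order 2m with m odd no element acts as -1, and odd bonds again connect the commuting
   pairs. The case |I| = 3 reduces to |I| = 1 by multiplication by the central element -1, which
   negates the trace. *)

theory Submission
  imports Defs
begin

section \<open>Coxeter groups with finite bonds\<close>

text \<open>Elements are handled as words, with \<open>rev\<close> as inversion. The locale supplies
  finitely many generators and finite bonds but no finite group, so a longest element of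
  \<open>W_I\<close> has to be obtained from the involution itself. If \<open>u\<close> negates the
  simple roots of \<open>I\<close>, then \<open>len u = len v + len (rev u @ v)\<close> for every
  word \<open>v\<close> in \<open>I\<close>; lengths in \<open>W_I\<close> are therefore bounded and
  a longest \<open>v\<close> exists. When \<open>u\<close> has no descents outside \<open>I\<close>,
  the word \<open>u @ v\<close> has no descent at all, which makes it trivial and puts
  \<open>u\<close> into \<open>W_I\<close>. Every class of involutions contains such a
  \<open>u\<close>, because conjugation by a descent whose root is not negated shortens an
  involution by two. The same length identity identifies the longest elements in the theorem: it
  suffices to exhibit a word in \<open>I\<close> that negates the simple roots of
  \<open>I\<close>.\<close>

lemma coxeter_cong_rev:
  assumes "coxeter_matrix m" "coxeter_cong m u v"
  shows "coxeter_cong m (rev u) (rev v)"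
  using assms(2)
proof (induction rule: coxeter_cong.induct)
  case (relator s t)
  have "rev (concat (replicate n [s, t])) = concat (replicate n [t, s])" for n
    by (simp add: rev_concat)
  moreover have "m s t = m t s"
    using assms(1) by (simp add: coxeter_matrix_def)
  ultimately show ?case
    using coxeter_cong.relator[of m t s] by simp
qed (auto intro: coxeter_cong.intros)

text \<open>The relators have even length, so parity is a sign character of the group. It rules out
  \<open>len (u @ [s]) = len u\<close>.\<close>

lemma coxeter_cong_even_length:
  assumes "coxeter_cong m u v"
  shows "even (length u) \<longleftrightarrow> even (length v)"
  using assms
proof (induction rule: coxeter_cong.induct)
  case (relator s t)
  have "length (concat (replicate n [s, t])) = 2 * n" for n
    by (induction n) simp_all
  then show ?case by simp
qed auto

text \<open>Positivity of \<open>m\<close> excludes infinite bonds, which are encoded as 0. For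
  \<open>s \<noteq> t\<close> the angle \<open>pi / m s t\<close> then has nonzero sine, and the
  form is nondegenerate on the span of the two roots.\<close>

locale coxeter =
  fixes m :: "'s::finite \<Rightarrow> 's \<Rightarrow> nat"
  assumes matrix: "coxeter_matrix m" and m_pos: "\<And>s t. m s t > 0"
begin

abbreviation cong (infix "\<doteq>" 50) where "u \<doteq> v \<equiv> coxeter_cong m u v"
abbreviation refl :: "'s \<Rightarrow> real ^ 's \<Rightarrow> real ^ 's" where "refl \<equiv> simple_reflection m"
abbreviation act :: "'s list \<Rightarrow> real ^ 's \<Rightarrow> real ^ 's" where "act u \<equiv> foldr refl u"
abbreviation root :: "'s \<Rightarrow> real ^ 's" where "root s \<equiv> axis s 1"
abbreviation form :: "real ^ 's \<Rightarrow> real ^ 's \<Rightarrow> real" where "form \<equiv> coxeter_form m"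
abbreviation len :: "'s list \<Rightarrow> nat" where "len u \<equiv> coxeter_length (coxeter_elt m u)"

lemma m_diag [simp]: "m s s = 1"
  and m_sym: "m s t = m t s"
  and m_ge2: "s \<noteq> t \<Longrightarrow> m s t \<ge> 2"
  using matrix m_pos[of s t] unfolding coxeter_matrix_def
  by (auto, metis One_nat_def Suc_1 Suc_leI le_neq_implies_less)

declare coxeter_cong.refl [simp, intro]
lemmas cong_sym = coxeter_cong.sym[of m]
lemmas cong_trans [trans] = coxeter_cong.trans[of m]
lemmas cong_append = coxeter_cong.append[of m]

section \<open>Cancellation and inversion in the word congruence\<close>

lemma rev_append_cong: "rev u @ u \<doteq> []"
  by (rule coxeter_cong_rev_append[OF matrix])

lemma append_rev_cong: "u @ rev u \<doteq> []"
  using rev_append_cong[of "rev u"] by simp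

lemma square_cong: "[s, s] \<doteq> []"
  using rev_append_cong[of "[s]"] by simp

lemma cong_context: "u \<doteq> v \<Longrightarrow> p @ u @ q \<doteq> p @ v @ q"
  by (intro cong_append) auto

lemma cancel_left: "p @ u \<doteq> p @ v \<longleftrightarrow> u \<doteq> v"
proof
  assume "p @ u \<doteq> p @ v"
  then have "rev p @ (p @ u) \<doteq> rev p @ (p @ v)"
    by (rule cong_append[OF coxeter_cong.refl])
  moreover have cancel: "rev p @ p @ w \<doteq> w" for w
    using cong_context[OF rev_append_cong[of p], of "[]" w] by simp
  ultimately show "u \<doteq> v"
    using cancel[of u] cancel[of v] by (meson cong_sym cong_trans)
next
  assume "u \<doteq> v"
  then show "p @ u \<doteq> p @ v"
    by (intro cong_append) auto
qed

lemma cong_iff_rev_append: "u \<doteq> v \<longleftrightarrow> rev u @ v \<doteq> []"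
  using cancel_left[of "rev u" u v] rev_append_cong[of u] by (meson cong_sym cong_trans)

lemma drop_square: "p @ s # s # q \<doteq> p @ q"
  using cong_context[OF square_cong, of p s q] by simp

subsection \<open>Length\<close>

lemma len_cong: "u \<doteq> v \<Longrightarrow> len u = len v"
  using coxeter_elt_eq_iff[of m u v] by simp

lemma len_le: "u \<doteq> v \<Longrightarrow> len u \<le> length v"
  unfolding coxeter_length_def coxeter_elt_def by (rule Least_le) auto

lemma reduced_word: obtains v where "u \<doteq> v" "length v = len u"
proof -
  have "\<exists>v\<in>coxeter_elt m u. length v = len u"
    unfolding coxeter_length_def
    by (rule LeastI_ex) (auto simp: coxeter_elt_def)
  then show ?thesis
    using that by (auto simp: coxeter_elt_def)
qed

lemma len_0_iff: "len u = 0 \<longleftrightarrow> u \<doteq> []"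
  using reduced_word[of u] len_le[of u "[]"] by (metis le_zero_eq length_0_conv)

lemma len_append: "len (u @ v) \<le> len u + len v"
  by (metis cong_append len_le length_append reduced_word)

lemma len_rev: "len (rev u) = len u"
proof -
  have "len (rev u) \<le> len u" for u
    by (metis coxeter_cong_rev[OF matrix] len_le length_rev reduced_word)
  from this[of u] this[of "rev u"] show ?thesis by simp
qed

lemma even_len: "even (len u) \<longleftrightarrow> even (length u)"
  by (metis coxeter_cong_even_length reduced_word)

lemma len_snoc: "len (u @ [s]) = Suc (len u) \<or> Suc (len (u @ [s])) = len u"
proof -
  have "len (u @ [s]) \<le> len u + 1"
    using len_append[of u "[s]"] len_le[of "[s]" "[s]"] by simp
  moreover have "len u \<le> len (u @ [s]) + 1"
    using len_append[of "u @ [s]" "[s]"] len_le[of "[s]" "[s]"] len_cong[OF drop_square[of u s "[]"]]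
    by simp
  moreover have "even (len (u @ [s])) \<longleftrightarrow> odd (len u)"
    by (simp add: even_len)
  moreover have "a \<le> b + 1 \<Longrightarrow> b \<le> a + 1 \<Longrightarrow> (even a \<longleftrightarrow> odd b) \<Longrightarrow> a = Suc b \<or> Suc a = b"
    for a b :: nat
    by presburger
  ultimately show ?thesis
    by blast
qed

subsection \<open>The reflection representation\<close>

lemma form_root: "form (root s) x = (\<Sum>t\<in>UNIV. x $ t * (- cos (pi / real (m s t))))"
proof -
  have "form (root s) x = (\<Sum>r\<in>UNIV. if r = s then \<Sum>t\<in>UNIV. x $ t * (- cos (pi / real (m r t))) else 0)"
    unfolding coxeter_form_def by (intro sum.cong refl) (auto simp: axis_def)
  then show ?thesis by simp
qed

lemma form_root_root: "form (root s) (root t) = - cos (pi / real (m s t))"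
proof -
  have "form (root s) (root t) = (\<Sum>r\<in>UNIV. if r = t then - cos (pi / real (m s r)) else 0)"
    unfolding form_root by (intro sum.cong refl) (auto simp: axis_def)
  then show ?thesis by simp
qed

lemma form_commute: "form x y = form y x"
  unfolding coxeter_form_def by (subst sum.swap) (simp add: m_sym ac_simps)

lemma linear_form: "linear (form x)"
  unfolding coxeter_form_def
  by (rule linearI) (simp_all add: algebra_simps sum.distrib sum_distrib_left sum_negf sum_subtractf)

lemmas form_linear =
  linear_add[OF linear_form] linear_diff[OF linear_form] linear_scale[OF linear_form] linear_neg[OF linear_form]

lemma form_linear_left:
  "form (x + y) z = form x z + form y z" "form (x - y) z = form x z - form y z"
  "form (c *\<^sub>R x) z = c * form x z"
  by (simp_all add: form_commute[of _ z] form_linear)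

lemma refl_def: "refl s x = x - (2 * form (root s) x) *\<^sub>R root s"
  by (rule simple_reflection_def)

lemma linear_refl: "linear (refl s)"
  unfolding refl_def[abs_def]
  by (rule linearI) (simp_all add: form_linear algebra_simps)

lemma linear_act: "linear (act u)"
proof (induction u)
  case Nil
  show ?case by (simp add: linear_id id_def[symmetric])
next
  case (Cons s u)
  then show ?case using linear_compose[OF _ linear_refl, of "act u" s] by (simp add: o_def)
qed

lemmas act_linear =
  linear_add[OF linear_act] linear_diff[OF linear_act] linear_scale[OF linear_act] linear_neg[OF linear_act]

lemma act_append: "act (u @ v) x = act u (act v x)"
  by simp

lemma refl_root_self: "refl s (root s) = - root s"
  by (simp add: refl_def form_root_root vec_eq_iff)

lemma refl_root: "refl s (root t) = root t + (2 * cos (pi / real (m s t))) *\<^sub>R root s"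
  by (simp add: refl_def form_root_root)

lemma refl_nth: "i \<noteq> s \<Longrightarrow> refl s x $ i = x $ i"
  by (simp add: refl_def axis_def)

lemma refl_refl: "refl s (refl s x) = x"
  by (simp add: refl_def form_linear form_root_root algebra_simps)

lemma form_refl: "form (refl s x) (refl s y) = form x y"
  by (simp add: refl_def form_linear form_linear_left form_root_root form_commute[of x "root s"] algebra_simps)

lemma form_act: "form (act u x) (act u y) = form x y"
  by (induction u) (simp_all add: form_refl)

subsection \<open>Alternating words\<close>

text \<open>The alternating word of length \<open>k\<close> with last letter \<open>t\<close>. The
  last letter is fixed, not the first, because \<open>act\<close> applies it first; suffixes are
  again words \<open>alt s t j\<close>.\<close>

fun alt :: "'s \<Rightarrow> 's \<Rightarrow> nat \<Rightarrow> 's list" where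
  "alt s t 0 = []"
| "alt s t (Suc k) = alt t s k @ [t]"

lemma length_alt [simp]: "length (alt s t k) = k"
  by (induction k arbitrary: s t) auto

lemma set_alt: "set (alt s t k) \<subseteq> {s, t}"
  by (induction k arbitrary: s t) force+

lemma drop_alt: "drop j (alt s t (j + k)) = alt s t k"
  by (induction k arbitrary: s t) auto

lemma alt_double: "alt s t (2 * k) = concat (replicate k [s, t])"
proof (induction k)
  case (Suc k)
  have "concat (replicate (Suc n) xs) = concat (replicate n xs) @ xs" for n and xs :: "'s list"
    by (induction n) simp_all
  from this[of k "[s, t]"] Suc show ?case by simp
qed simp

lemma word_alt_or_square:
  assumes "set x \<subseteq> {s, t}"
  obtains k where "x = alt s t k" | k where "x = alt t s k" | p a q where "x = p @ a # a # q"
proof -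
  have "(\<exists>k. x = alt s t k) \<or> (\<exists>k. x = alt t s k) \<or> (\<exists>p a q. x = p @ a # a # q)"
    using assms
  proof (induction x rule: rev_induct)
    case Nil
    have "[] = alt s t 0" by simp
    then show ?case by blast
  next
    case (snoc b x)
    have step: "(\<exists>k. x @ [b] = alt s' t' k) \<or> (\<exists>k. x @ [b] = alt t' s' k) \<or> (\<exists>p a q. x @ [b] = p @ a # a # q)"
      if x: "x = alt s' t' k" and b: "b = s' \<or> b = t'" for x s' t' k
    proof (cases k)
      case 0
      then have "x @ [b] = alt s' t' 1 \<or> x @ [b] = alt t' s' 1" using x b by auto
      then show ?thesis by blast
    next
      case (Suc j)
      then have "x @ [b] = alt t' s' (Suc k) \<or> x @ [b] = alt t' s' j @ t' # t' # []"
        using x b by auto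
      then show ?thesis by blast
    qed
    have b: "b = s \<or> b = t" using snoc.prems by auto
    consider k where "x = alt s t k" | k where "x = alt t s k" | p a q where "x = p @ a # a # q"
      using snoc by auto
    then show ?case
    proof cases
      case 3
      then have "x @ [b] = p @ a # a # (q @ [b])" by simp
      then show ?thesis by blast
    qed (use b step[of x s t] step[of x t s] in blast)+
  qed
  then show ?thesis using that by blast
qed

text \<open>\<open>cheb s t k\<close> is the value at \<open>cos (\<pi> / m s t)\<close> of the Chebyshev polynomial of the second
  kind of degree \<open>k - 1\<close>.\<close>

definition cheb :: "'s \<Rightarrow> 's \<Rightarrow> nat \<Rightarrow> real" where
  "cheb s t k = sin (real k * (pi / real (m s t))) / sin (pi / real (m s t))"

section \<open>Chebyshev values and the dihedral orbit of a simple root\<close>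

lemma sin_pos: "s \<noteq> t \<Longrightarrow> sin (pi / real (m s t)) > 0"
  using m_ge2[of s t] by (intro sin_gt_zero) (auto simp: field_simps)

lemma cheb_sym: "cheb s t = cheb t s"
  by (simp add: cheb_def m_sym fun_eq_iff)

lemma cheb_0 [simp]: "cheb s t 0 = 0"
  by (simp add: cheb_def)

lemma cheb_1 [simp]: "s \<noteq> t \<Longrightarrow> cheb s t (Suc 0) = 1"
  using sin_pos[of s t] by (simp add: cheb_def)

lemma cheb_Suc_Suc:
  "cheb s t (Suc (Suc k)) = 2 * cos (pi / real (m s t)) * cheb s t (Suc k) - cheb s t k"
proof -
  define h where "h = pi / real (m s t)"
  have "sin (real (Suc (Suc k)) * h) = sin (real (Suc k) * h + h)"
    and "sin (real k * h) = sin (real (Suc k) * h - h)"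
    by (simp_all add: algebra_simps)
  then have "sin (real (Suc (Suc k)) * h) = 2 * cos h * sin (real (Suc k) * h) - sin (real k * h)"
    by (simp only: sin_add sin_diff) simp
  then show ?thesis
    unfolding cheb_def h_def[symmetric] by (simp add: diff_divide_distrib[symmetric])
qed

lemma cheb_nonneg: "k \<le> m s t \<Longrightarrow> cheb s t k \<ge> 0"
proof (cases "s = t")
  case False
  assume "k \<le> m s t"
  then have "real k * (pi / real (m s t)) \<le> pi"
    using m_pos[of s t] by (simp add: field_simps)
  then show ?thesis
    unfolding cheb_def using sin_pos[OF False] by (intro divide_nonneg_pos sin_ge_zero) auto
qed (simp add: cheb_def)

lemma cheb_m: "cheb s t (m s t) = 0"
  using m_pos[of s t] by (simp add: cheb_def)

lemma cheb_2m: "cheb s t (2 * m s t) = 0"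
  using m_pos[of s t] by (simp add: cheb_def mult.assoc)

lemma cheb_pred_m: "s \<noteq> t \<Longrightarrow> cheb s t (m s t - 1) = 1"
proof -
  assume "s \<noteq> t"
  have "real (m s t - 1) * (pi / real (m s t)) = pi - pi / real (m s t)"
    using m_pos[of s t] by (simp add: field_simps of_nat_diff Suc_leI)
  then show ?thesis using sin_pos[OF \<open>s \<noteq> t\<close>] by (simp add: cheb_def)
qed

lemma cheb_Suc_2m: "s \<noteq> t \<Longrightarrow> cheb s t (Suc (2 * m s t)) = 1"
proof -
  assume "s \<noteq> t"
  have "real (Suc (2 * m s t)) * (pi / real (m s t)) = pi / real (m s t) + 2 * pi"
    using m_pos[of s t] by (simp add: field_simps)
  then show ?thesis using sin_pos[OF \<open>s \<noteq> t\<close>] by (simp add: cheb_def)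
qed

lemma cheb_pred_2m: "s \<noteq> t \<Longrightarrow> cheb s t (2 * m s t - 1) = -1"
proof -
  assume "s \<noteq> t"
  have "real (2 * m s t - 1) * (pi / real (m s t)) = 2 * pi - pi / real (m s t)"
    using m_pos[of s t] by (simp add: field_simps of_nat_diff Suc_leI)
  then show ?thesis using sin_pos[OF \<open>s \<noteq> t\<close>] by (simp add: cheb_def sin_diff)
qed

text \<open>Letting the last letter \<open>t\<close> act turns \<open>root s\<close> into
  \<open>root s\<close> plus a multiple of \<open>root t\<close>. The two summands fall under the
  cases \<open>k - 2\<close> and \<open>k - 1\<close>, the latter with \<open>s\<close> and
  \<open>t\<close> exchanged, and the Chebyshev recurrence joins them.\<close>

lemma act_alt_root:
  assumes "s \<noteq> t"
  shows "act (alt s t k) (root s) =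
    (if even k then cheb s t (Suc k) *\<^sub>R root s + cheb s t k *\<^sub>R root t
     else cheb s t k *\<^sub>R root s + cheb s t (Suc k) *\<^sub>R root t)"
  using assms
proof (induction k arbitrary: s t rule: less_induct)
  case (less k)
  consider "k = 0" | "k = 1" | j where "k = Suc (Suc j)"
    by (metis One_nat_def not0_implies_Suc)
  then show ?case
  proof cases
    case 1
    then show ?thesis using less.prems by simp
  next
    case 2
    then show ?thesis using less.prems
      by (simp add: refl_root cheb_Suc_Suc m_sym[of t s])
  next
    case 3
    have "act (alt s t k) (root s) = act (alt t s (Suc j)) (root s + (2 * cos (pi / real (m s t))) *\<^sub>R root t)"
      by (simp add: 3 refl_root m_sym[of t s])
    also have "\<dots> = act (alt t s (Suc j)) (root s) + (2 * cos (pi / real (m s t))) *\<^sub>R act (alt t s (Suc j)) (root t)"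
      by (simp only: act_linear)
    \<comment> \<open>Here \<open>alt t s (Suc j)\<close> is \<open>alt s t j @ [s]\<close>, and its
      last letter negates \<open>root s\<close>.\<close>
    also have "act (alt t s (Suc j)) (root s) = - act (alt s t j) (root s)"
      by (simp add: refl_root_self act_linear)
    finally have step: "act (alt s t k) (root s) = - act (alt s t j) (root s)
        + (2 * cos (pi / real (m s t))) *\<^sub>R act (alt t s (Suc j)) (root t)" .
    have IH: "act (alt s t j) (root s) = (if even j then cheb s t (Suc j) *\<^sub>R root s + cheb s t j *\<^sub>R root t
         else cheb s t j *\<^sub>R root s + cheb s t (Suc j) *\<^sub>R root t)"
      "act (alt t s (Suc j)) (root t) = (if odd j then cheb s t (Suc (Suc j)) *\<^sub>R root t + cheb s t (Suc j) *\<^sub>R root s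
         else cheb s t (Suc j) *\<^sub>R root t + cheb s t (Suc (Suc j)) *\<^sub>R root s)"
      using less.IH[of j s t] less.IH[of "Suc j" t s] less.prems 3 by (simp_all add: cheb_sym[of t s] del: alt.simps)
    show ?thesis
      unfolding step IH
      by (simp add: 3 cheb_sym[of t s] cheb_Suc_Suc[of _ _ "Suc j"] cheb_Suc_Suc[of _ _ j] algebra_simps)
  qed
qed

section \<open>The relators act trivially\<close>

lemma act_relator_roots:
  assumes "s \<noteq> t"
  shows "act (concat (replicate (m s t) [s, t])) (root s) = root s" (is "act ?w _ = _")
    and "act (concat (replicate (m s t) [s, t])) (root t) = root t"
proof -
  have w: "?w = alt s t (2 * m s t)" by (rule alt_double[symmetric])
  show "act ?w (root s) = root s"
    unfolding w act_alt_root[OF assms] using assms by (simp add: cheb_2m cheb_Suc_2m)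
  obtain k where k: "2 * m s t = Suc k" "odd k"
    using m_pos[of s t] by (metis even_Suc even_mult_iff even_numeral mult_is_0 not0_implies_Suc not_numeral_le_zero numeral_One zero_neq_numeral less_not_refl)
  then have k1: "k = 2 * m s t - 1" by simp
  have "act ?w (root t) = - act (alt t s k) (root t)"
    unfolding w k(1) by (simp add: refl_root_self act_linear)
  also have "\<dots> = root t"
    using assms k cheb_pred_2m[OF assms] cheb_2m[of s t]
    by (simp add: act_alt_root cheb_sym[of t s] k1[symmetric])
  finally show "act ?w (root t) = root t" .
qed

lemma act_orthogonal:
  assumes "form (root s) x = 0" "form (root t) x = 0" "set u \<subseteq> {s, t}"
  shows "act u x = x"
  using assms(3) by (induction u) (auto simp: refl_def assms)

text \<open>The space splits into the span of the two roots, where the relator is a full turn, and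
  its orthogonal complement, which both reflections fix pointwise.\<close>

lemma act_relator: "act (concat (replicate (m s t) [s, t])) x = x" (is "act ?w x = x")
proof (cases "s = t")
  case True
  then show ?thesis by (simp add: refl_refl)
next
  case False
  define h c p q where "h = pi / real (m s t)" and "c = cos h" and "p = form (root s) x" and "q = form (root t) x"
  have nz: "sin h \<noteq> 0" using sin_pos[OF False] by (simp add: h_def)
  \<comment> \<open>The coefficients of the projection of \<open>x\<close> to the span of the two
    roots: they solve \<open>a - c * b = p\<close>, \<open>b - c * a = q\<close>, a system whose
    determinant is the square of \<open>sin h\<close>.\<close>
  define a b where "a = (p + c * q) / (sin h)\<^sup>2" and "b = (q + c * p) / (sin h)\<^sup>2"
  define y where "y = x - a *\<^sub>R root s - b *\<^sub>R root t"
  have s2: "(sin h)\<^sup>2 = 1 - c\<^sup>2" by (simp add: c_def sin_squared_eq)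
  then have nz': "1 - c\<^sup>2 \<noteq> 0" using nz by (metis power_not_zero)
  have ab: "a - c * b = p" "b - c * a = q"
    using nz' unfolding a_def b_def s2 by (simp_all add: divide_simps) (simp_all add: algebra_simps power2_eq_square)
  have "form (root s) y = p - a + b * c" "form (root t) y = q + a * c - b"
    by (simp_all add: y_def form_linear form_root_root p_def q_def c_def h_def m_sym[of t s])
  then have "form (root s) y = 0" "form (root t) y = 0"
    using ab by (simp_all add: algebra_simps)
  moreover have "set ?w \<subseteq> {s, t}" by auto
  ultimately have "act ?w y = y" by (rule act_orthogonal)
  moreover have "x = y + a *\<^sub>R root s + b *\<^sub>R root t" by (simp add: y_def)
  ultimately show ?thesis
    by (simp only: act_linear act_relator_roots[OF False])
qed

lemma act_cong: "u \<doteq> v \<Longrightarrow> act u = act v"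
proof (induction rule: coxeter_cong.induct)
  case (relator s t)
  then show ?case by (intro ext) (simp only: act_relator, simp)
qed (auto simp: fun_eq_iff)

lemma act_rev_act [simp]: "act (rev u) (act u x) = x"
  using act_cong[OF rev_append_cong[of u]] by (simp add: fun_eq_iff)

lemma reflection_rep_elt: "reflection_rep m (coxeter_elt m u) = act u"
proof -
  have "act ` coxeter_elt m u = {act u}"
    unfolding coxeter_elt_def using act_cong by (auto intro: image_eqI[of _ _ u])
  then show ?thesis by (simp add: reflection_rep_def)
qed

subsection \<open>Descents\<close>

text \<open>The two halves of the relator are inverse to each other, so the second half equals the
  reversed first half, which ends in \<open>s\<close> because the relator begins with
  \<open>s\<close>. This is the braid relation in the form that exposes a descent at
  \<open>s\<close>.\<close>

lemma alt_m_cong: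
  obtains y where "length y = m s t - 1" "alt s t (m s t) \<doteq> y @ [s]"
proof -
  define k z where "k = m s t" and "z = concat (replicate k [s, t])"
  obtain j where j: "k = Suc j" using m_pos[of s t] by (metis k_def gr0_implies_Suc)
  have z: "z = alt s t (k + k)" unfolding z_def by (simp add: alt_double[symmetric] mult_2)
  have "take k z @ alt s t k = z"
    using append_take_drop_id[of k z] by (simp add: z drop_alt)
  then have "take k z @ alt s t k \<doteq> []"
    using coxeter_cong.relator[of m s t] by (simp add: z_def k_def)
  then have "rev (take k z) \<doteq> alt s t k"
    by (simp add: cong_iff_rev_append[of "rev (take k z)"])
  moreover have "take k z = s # take j (tl z)" by (simp add: z_def j)
  moreover have "length z = k + k" by (simp add: z)
  ultimately show ?thesis
    using that[of "rev (take j (tl z))"] j cong_sym by (auto simp: k_def)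
qed

text \<open>Writing \<open>w = v x\<close> with \<open>x\<close> in the dihedral subgroup of \<open>s\<close> and of the last letter \<open>t\<close> of
  \<open>w\<close>, and \<open>v\<close> as short as possible, reduces the claim to \<open>v\<close> and to the roots of the dihedral
  group.\<close>

lemma ascent_nonneg: "len w < len (w @ [s]) \<Longrightarrow> 0 \<le> act w (root s)"
proof (induction "len w" arbitrary: w s rule: less_induct)
  case less
  have root_nonneg: "0 \<le> root a" for a
    by (simp add: less_eq_vec_def axis_def)
  obtain r where r: "w \<doteq> r" "length r = len w" by (rule reduced_word)
  show ?case
  proof (cases r rule: rev_cases)
    case Nil
    then show ?thesis using act_cong[OF r(1)] root_nonneg by simp
  next
    case (snoc r0 t)
    have "s \<noteq> t"
    proof
      assume "s = t"
      then have "w @ [s] \<doteq> r0 @ s # s # []"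
        using cong_append[OF r(1), of "[s]" "[s]"] snoc by simp
      then have "w @ [s] \<doteq> r0"
        using drop_square[of r0 s "[]"] by (metis append_Nil2 cong_trans)
      then show False using len_le[of "w @ [s]" r0] less.prems r snoc by simp
    qed
    define P where "P n \<longleftrightarrow> (\<exists>v x. w \<doteq> v @ x \<and> set x \<subseteq> {s, t} \<and> length v + length x = len w \<and> length v = n)" for n
    have P0: "P (length r0)"
      unfolding P_def using r snoc by (intro exI[of _ r0] exI[of _ "[t]"]) auto
    then have "P (LEAST n. P n)" by (rule LeastI)
    then obtain v x where w: "w \<doteq> v @ x" and x: "set x \<subseteq> {s, t}"
      and lvx: "length v + length x = len w" and lv: "length v = (LEAST n. P n)"
      unfolding P_def by blast
    have v_min: "length v \<le> n" if "P n" for n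
      unfolding lv using that by (rule Least_le)
    have short: "length v < len w" using v_min[OF P0] r snoc by simp
    have len_x: "len x \<le> length x" by (rule len_le) simp
    have len_v: "len v = length v"
      using len_le[of v v] len_append[of v x] len_cong[OF w] lvx len_x by simp
    \<comment> \<open>A descent of \<open>v\<close> at \<open>a\<close> could be moved into the
      dihedral factor, giving a factorization of the same total length with a shorter left
      part.\<close>
    have ascent: "len v < len (v @ [a])" if a: "a \<in> {s, t}" for a
    proof (rule ccontr)
      assume "\<not> ?thesis"
      then have *: "Suc (len (v @ [a])) = len v" using len_snoc[of v a] by auto
      obtain v' where v': "v @ [a] \<doteq> v'" "length v' = len (v @ [a])" by (rule reduced_word)
      have "w \<doteq> (v @ [a]) @ a # x"
        using cong_trans[OF w cong_sym[OF drop_square[of v a x]]] by simp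
      also have "\<dots> \<doteq> v' @ a # x" by (intro cong_append v') simp
      finally have "P (length v')"
        unfolding P_def using a x v' * lvx len_v by (intro exI[of _ v'] exI[of _ "a # x"]) auto
      then show False using v_min[of "length v'"] v' * len_v by simp
    qed
    have nonneg: "0 \<le> act v (root s)" "0 \<le> act v (root t)"
      using less.hyps[of v] ascent short len_v by auto
    have minimal: "length x \<le> length y" if "x \<doteq> y" for y
    proof -
      have "w \<doteq> v @ y" using cong_trans[OF w cong_append[OF coxeter_cong.refl that]] .
      then show ?thesis using len_le[of w "v @ y"] lvx by simp
    qed
    have no_s: "length x \<le> length y" if "x \<doteq> y @ [s]" for y
    proof -
      have "w @ [s] \<doteq> (v @ x) @ [s]" using w by (intro cong_append) auto
      also have "\<dots> = v @ x @ [s]" by simp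
      also have "\<dots> \<doteq> v @ (y @ [s]) @ [s]" using that by (rule cong_context)
      also have "\<dots> = (v @ y) @ s # s # []" by simp
      also have "\<dots> \<doteq> (v @ y) @ []" by (rule drop_square)
      finally show ?thesis using len_le[of "w @ [s]" "v @ y"] less.prems lvx by simp
    qed
    \<comment> \<open>Minimality excludes a square in \<open>x\<close>, and \<open>x\<close> cannot
      end in \<open>s\<close> since \<open>w @ [s]\<close> is longer than \<open>w\<close>. So
      \<open>x\<close> is empty or alternating with last letter \<open>t\<close>.\<close>
    obtain k where k: "x = alt s t k"
      using x
    proof (cases rule: word_alt_or_square)
      case (2 k)
      then show ?thesis
        using no_s[of "alt s t (k - 1)"] that[of 0] by (cases k) auto
    next
      case (3 p a q)
      then show ?thesis using minimal[OF drop_square[of p a q, folded 3]] by simp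
    qed (use that in blast)
    \<comment> \<open>From length \<open>m s t\<close> on, the braid relation would let
      \<open>x\<close> end in \<open>s\<close>. The strict bound also keeps \<open>Suc k\<close> in
      the range where \<open>cheb\<close> is nonnegative.\<close>
    have "k < m s t"
    proof (rule ccontr)
      assume "\<not> ?thesis"
      then have mk: "m s t \<le> k" by simp
      obtain y where y: "length y = m s t - 1" "alt s t (m s t) \<doteq> y @ [s]"
        by (rule alt_m_cong)
      define p where "p = take (k - m s t) x"
      have "drop (k - m s t) x = alt s t (m s t)"
        using drop_alt[of "k - m s t" s t "m s t"] mk by (simp add: k)
      then have "x = p @ alt s t (m s t)"
        unfolding p_def by (metis append_take_drop_id)
      also have "\<dots> \<doteq> p @ y @ [s]" using y(2) by (intro cong_append) auto
      finally have "length x \<le> length (p @ y)" by (intro no_s) simp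
      moreover have "length (p @ y) = k - m s t + (m s t - 1)" using y by (simp add: p_def k)
      ultimately show False using mk m_pos[of s t] by (simp add: k)
    qed
    then have "\<exists>a b. 0 \<le> a \<and> 0 \<le> b \<and> act x (root s) = a *\<^sub>R root s + b *\<^sub>R root t"
      using cheb_nonneg[of k s t] cheb_nonneg[of "Suc k" s t]
      unfolding k act_alt_root[OF \<open>s \<noteq> t\<close>] by (auto simp del: of_nat_Suc)
    then obtain a b where ab: "0 \<le> a" "0 \<le> b" "act x (root s) = a *\<^sub>R root s + b *\<^sub>R root t"
      by blast
    have "act w (root s) = a *\<^sub>R act v (root s) + b *\<^sub>R act v (root t)"
      unfolding act_cong[OF w] act_append ab(3) by (simp only: act_linear)
    then show ?thesis using ab nonneg by (simp add: scaleR_nonneg_nonneg)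
  qed
qed

lemma descent_nonpos:
  assumes "len (w @ [s]) < len w"
  shows "act w (root s) \<le> 0"
proof -
  have "len ((w @ [s]) @ [s]) = len w"
    using len_cong[OF drop_square[of w s "[]"]] by simp
  then have "0 \<le> act (w @ [s]) (root s)" using assms by (intro ascent_nonneg) simp
  then show ?thesis by (simp add: refl_root_self act_linear)
qed

lemma act_root_nonzero: "act w (root s) \<noteq> 0"
proof
  assume "act w (root s) = 0"
  then have "act (rev w) (act w (root s)) = 0"
    by (simp add: linear_0[OF linear_act] del: act_rev_act)
  then show False by (simp add: axis_eq_0_iff)
qed

lemma act_root_sign: "0 \<le> act w (root s) \<or> act w (root s) \<le> 0"
  using len_snoc[of w s] ascent_nonneg[of w s] descent_nonpos[of w s] by (metis lessI)

lemma len_ascent: "0 \<le> act w (root s) \<Longrightarrow> len (w @ [s]) = Suc (len w)"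
  using len_snoc[of w s] descent_nonpos[of w s] act_root_nonzero[of w s] by (metis antisym lessI)

lemma len_descent: "act w (root s) \<le> 0 \<Longrightarrow> Suc (len (w @ [s])) = len w"
  using len_snoc[of w s] ascent_nonneg[of w s] act_root_nonzero[of w s] by (metis antisym lessI)

lemma act_root_pos_coord:
  assumes "act w (root s) $ i > 0"
  shows "0 \<le> act w (root s)"
proof (rule ccontr)
  assume "\<not> ?thesis"
  then have "act w (root s) $ i \<le> 0 $ i"
    using act_root_sign[of w s] unfolding less_eq_vec_def by blast
  then show False using assms by simp
qed

text \<open>The last letter of a nonempty reduced word is always a descent.\<close>

lemma no_descent_cong_Nil:
  assumes "\<And>s. 0 \<le> act w (root s)"
  shows "w \<doteq> []"
proof -
  obtain r where r: "w \<doteq> r" "length r = len w" by (rule reduced_word)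
  show ?thesis
  proof (cases r rule: rev_cases)
    case (snoc r0 s)
    have "w @ [s] \<doteq> (r0 @ [s]) @ [s]"
      using r snoc by (intro cong_append) auto
    also have "\<dots> \<doteq> r0" using drop_square[of r0 s "[]"] by simp
    finally have "len (w @ [s]) < len w" using len_le[of "w @ [s]" r0] r snoc by simp
    then show ?thesis using len_ascent[OF assms[of s]] by simp
  qed (use r in simp)
qed

text \<open>If \<open>u\<close> and \<open>v\<close> act alike, \<open>rev u @ v\<close> fixes every
  simple root and so has no descent. Faithfulness turns later identities between words into
  computations with vectors.\<close>

lemma cong_iff_act: "u \<doteq> v \<longleftrightarrow> act u = act v"
proof
  assume eq: "act u = act v"
  have "act (rev u @ v) (root s) = root s" for s
    using act_rev_act[of u "root s"] by (simp add: eq)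
  then have "rev u @ v \<doteq> []"
    by (intro no_descent_cong_Nil) (simp add: less_eq_vec_def axis_def del: foldr_append)
  then show "u \<doteq> v" by (rule cong_iff_rev_append[THEN iffD2])
qed (rule act_cong)

subsection \<open>Longest elements\<close>

text \<open>No condition is put on the letters of \<open>w\<close>, so that an involution can be
  described in this way before it is known to lie in \<open>W_I\<close>.\<close>

definition acts_neg :: "'s list \<Rightarrow> 's set \<Rightarrow> bool" where
  "acts_neg w I \<longleftrightarrow> (\<forall>s\<in>I. act w (root s) = - root s)"

lemma root_expansion:
  assumes "\<And>i. i \<notin> I \<Longrightarrow> x $ i = 0"
  shows "x = (\<Sum>s\<in>I. x $ s *\<^sub>R root s)"
proof (rule vec_eq_iff[THEN iffD2, rule_format])
  fix i
  have "(\<Sum>s\<in>I. x $ s *\<^sub>R root s) $ i = (\<Sum>s\<in>I. if s = i then x $ s else 0)"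
    unfolding sum_component by (intro sum.cong) (auto simp: axis_def)
  then show "x $ i = (\<Sum>s\<in>I. x $ s *\<^sub>R root s) $ i"
    using assms[of i] by simp
qed

lemma acts_neg_span:
  assumes "acts_neg w I" "\<And>i. i \<notin> I \<Longrightarrow> x $ i = 0"
  shows "act w x = - x"
proof -
  have x: "x = (\<Sum>s\<in>I. x $ s *\<^sub>R root s)"
    by (rule root_expansion[OF assms(2)])
  have "act w x = act w (\<Sum>s\<in>I. x $ s *\<^sub>R root s)"
    by (rule arg_cong[OF x])
  also have "\<dots> = (\<Sum>s\<in>I. act w (x $ s *\<^sub>R root s))"
    by (rule linear_sum[OF linear_act])
  also have "\<dots> = (\<Sum>s\<in>I. - (x $ s *\<^sub>R root s))"
    using assms(1) by (intro sum.cong) (auto simp: acts_neg_def act_linear)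
  also have "\<dots> = - x"
    unfolding sum_negf x[symmetric] ..
  finally show ?thesis .
qed

lemma acts_neg_rev:
  assumes "acts_neg w I"
  shows "acts_neg (rev w) I"
  unfolding acts_neg_def
proof
  fix s assume "s \<in> I"
  then have "act (rev w) (- act w (root s)) = - root s"
    unfolding act_linear act_rev_act by simp
  then show "act (rev w) (root s) = - root s"
    using assms \<open>s \<in> I\<close> by (simp add: acts_neg_def)
qed

lemma act_nth_outside: "set v \<subseteq> I \<Longrightarrow> i \<notin> I \<Longrightarrow> act v x $ i = x $ i"
  by (induction v) (auto, metis refl_nth)

text \<open>The root \<open>act v (root s)\<close> lies in the span of \<open>I\<close>, so
  \<open>rev w\<close> negates it. Appending \<open>s\<close> therefore lengthens one of
  \<open>v\<close> and \<open>rev w @ v\<close> and shortens the other.\<close>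

lemma len_split:
  assumes w: "acts_neg w I" and v: "set v \<subseteq> I"
  shows "len w = len v + len (rev w @ v)"
  using v
proof (induction v rule: rev_induct)
  case Nil
  then show ?case by (simp add: len_rev len_0_iff[THEN iffD2])
next
  case (snoc s v)
  have "act (rev w) (act v (root s)) = - act v (root s)"
    using snoc.prems by (intro acts_neg_span[OF acts_neg_rev[OF w]])
      (auto simp: act_nth_outside[of v I] axis_def)
  then have eq: "act (rev w @ v) (root s) = - act v (root s)" by simp
  consider "0 \<le> act v (root s)" | "act v (root s) \<le> 0" using act_root_sign by blast
  then show ?case
  proof cases
    case 1
    then show ?thesis
      using snoc len_ascent[OF 1] len_descent[of "rev w @ v" s] eq by simp
  next
    case 2
    then show ?thesis
      using snoc len_descent[OF 2] len_ascent[of "rev w @ v" s] eq by simp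
  qed
qed

lemma acts_neg_longest:
  assumes "acts_neg w I" "set v \<subseteq> I"
  shows "len v \<le> len w" and "len v = len w \<Longrightarrow> w \<doteq> v"
  using len_split[OF assms] by (simp_all add: len_0_iff cong_iff_rev_append[of w v])

lemma acts_neg_unique:
  assumes "acts_neg w I" "acts_neg v I" "set v \<subseteq> I" "set w \<subseteq> I"
  shows "w \<doteq> v"
  using acts_neg_longest[OF assms(1,3)] acts_neg_longest[OF assms(2,4)] by simp

lemma carrier_eq: "carrier (coxeter_group m) = range (coxeter_elt m)"
  and one_eq: "\<one>\<^bsub>coxeter_group m\<^esub> = coxeter_elt m []"
  by (simp_all add: coxeter_group_def)

lemma parabolic_eq: "parabolic m I = coxeter_elt m ` {v. set v \<subseteq> I}"
proof -
  interpret G: group "coxeter_group m" by (rule group_coxeter_group[OF matrix])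
  have gen_inv: "inv\<^bsub>coxeter_group m\<^esub> (coxeter_elt m [s]) = coxeter_elt m [s]" for s
  proof (rule G.inv_equality)
    show "coxeter_elt m [s] \<otimes>\<^bsub>coxeter_group m\<^esub> coxeter_elt m [s] = \<one>\<^bsub>coxeter_group m\<^esub>"
      using square_cong[of s] by (simp add: coxeter_mult_elt coxeter_elt_eq_iff one_eq)
  qed (simp_all add: carrier_eq)
  show ?thesis
  proof (intro equalityI subsetI)
    fix x assume "x \<in> parabolic m I"
    then show "x \<in> coxeter_elt m ` {v. set v \<subseteq> I}"
      unfolding parabolic_def
    proof (induction rule: generate.induct)
      case one
      then show ?case by (auto simp: one_eq intro!: image_eqI[of _ _ "[]"])
    next
      case (incl h)
      then obtain s where "s \<in> I" "h = coxeter_elt m [s]" by (auto simp: simple_gen_def)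
      then show ?case by (intro image_eqI[of _ _ "[s]"]) auto
    next
      case (inv h)
      then obtain s where "s \<in> I" "h = coxeter_elt m [s]" by (auto simp: simple_gen_def)
      then show ?case using \<open>s \<in> I\<close> by (intro image_eqI[of _ _ "[s]"]) (simp_all add: gen_inv)
    next
      case (eng g h)
      then obtain u v where "set u \<subseteq> I" "set v \<subseteq> I" "g = coxeter_elt m u" "h = coxeter_elt m v"
        by auto
      then show ?case by (intro image_eqI[of _ _ "u @ v"]) (auto simp: coxeter_mult_elt)
    qed
  next
    have "set v \<subseteq> I \<Longrightarrow> coxeter_elt m v \<in> parabolic m I" for v
    proof (induction v)
      case Nil
      then show ?case
        using generate.one[of "coxeter_group m"] by (simp add: parabolic_def one_eq)
    next
      case (Cons s v)
      then have "simple_gen m s \<otimes>\<^bsub>coxeter_group m\<^esub> coxeter_elt m v \<in> parabolic m I"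
        unfolding parabolic_def by (intro generate.eng[OF generate.incl]) auto
      then show ?case by (simp add: simple_gen_def coxeter_mult_elt)
    qed
    then show "\<And>x. x \<in> coxeter_elt m ` {v. set v \<subseteq> I} \<Longrightarrow> x \<in> parabolic m I"
      by auto
  qed
qed

text \<open>The length identity leaves only \<open>w\<close> at the maximal length, which gives the
  definite description its value.\<close>

lemma longest_elt_eq:
  assumes "acts_neg w I" "set w \<subseteq> I"
  shows "longest_elt m I = coxeter_elt m w"
  unfolding longest_elt_def parabolic_eq
proof (rule the_equality)
  show "coxeter_elt m w \<in> coxeter_elt m ` {v. set v \<subseteq> I} \<and>
    (\<forall>x\<in>coxeter_elt m ` {v. set v \<subseteq> I}. coxeter_length x \<le> coxeter_length (coxeter_elt m w))"
    using assms acts_neg_longest(1)[OF assms(1)] by auto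
next
  fix x
  assume "x \<in> coxeter_elt m ` {v. set v \<subseteq> I} \<and>
    (\<forall>y\<in>coxeter_elt m ` {v. set v \<subseteq> I}. coxeter_length y \<le> coxeter_length x)"
  then obtain v where v: "x = coxeter_elt m v" "set v \<subseteq> I" "len w \<le> len v"
    using assms(2) by auto
  then have "w \<doteq> v"
    using acts_neg_longest[OF assms(1) v(2)] by simp
  then show "x = coxeter_elt m w"
    using v(1) by (simp add: coxeter_elt_eq_iff cong_sym)
qed

subsection \<open>Conjugacy\<close>

definition conj :: "'s list \<Rightarrow> 's list \<Rightarrow> bool" where
  "conj u v \<longleftrightarrow> (\<exists>g. g @ u @ rev g \<doteq> v)"

lemma cong_imp_conj: "u \<doteq> v \<Longrightarrow> conj u v"
  unfolding conj_def by (rule exI[of _ "[]"]) simp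

lemma conj_trans [trans]:
  assumes "conj u v" "conj v w"
  shows "conj u w"
proof -
  obtain g h where g: "g @ u @ rev g \<doteq> v" and h: "h @ v @ rev h \<doteq> w"
    using assms by (auto simp: conj_def)
  have "h @ (g @ u @ rev g) @ rev h \<doteq> w"
    by (rule cong_trans[OF cong_context[OF g] h])
  then show ?thesis
    unfolding conj_def by (intro exI[of _ "h @ g"]) simp
qed

lemma act_act_rev [simp]: "act u (act (rev u) x) = x"
  using act_rev_act[of "rev u" x] by simp

lemma conj_sym:
  assumes "conj u v"
  shows "conj v u"
proof -
  obtain g where "g @ u @ rev g \<doteq> v"
    using assms by (auto simp: conj_def)
  then have v: "act v = act (g @ u @ rev g)"
    by (simp only: cong_iff_act)
  have "rev g @ v @ rev (rev g) \<doteq> u"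
    unfolding cong_iff_act by (rule ext) (simp add: v)
  then show ?thesis unfolding conj_def by blast
qed

text \<open>Since \<open>g\<close> preserves the form, conjugation by \<open>g\<close> turns the
  reflection in a root into the reflection in its image, and opposite roots have the same
  reflection.\<close>

lemma conj_generator:
  assumes "act g (root s) = root t \<or> act g (root s) = - root t"
  shows "g @ [s] @ rev g \<doteq> [t]"
  unfolding cong_iff_act
proof (rule ext)
  fix x
  have "form (root s) (act (rev g) x) = form (act g (root s)) x"
    using form_act[of g "root s" "act (rev g) x"] by simp
  then have "act (g @ [s] @ rev g) x = x - (2 * form (act g (root s)) x) *\<^sub>R act g (root s)"
    by (simp add: refl_def act_linear)
  also have "\<dots> = act [t] x"
    using assms by (auto simp: refl_def form_commute[of _ x] form_linear)
  finally show "act (g @ [s] @ rev g) x = act [t] x" .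
qed

lemma inv_elt: "inv\<^bsub>coxeter_group m\<^esub> (coxeter_elt m u) = coxeter_elt m (rev u)"
proof -
  interpret G: group "coxeter_group m" by (rule group_coxeter_group[OF matrix])
  show ?thesis
  proof (rule G.inv_equality)
    show "coxeter_elt m (rev u) \<otimes>\<^bsub>coxeter_group m\<^esub> coxeter_elt m u = \<one>\<^bsub>coxeter_group m\<^esub>"
      using rev_append_cong[of u] by (simp add: coxeter_mult_elt coxeter_elt_eq_iff one_eq)
  qed (simp_all add: carrier_eq)
qed

lemma conj_class_elt:
  "conj_class (coxeter_group m) (coxeter_elt m u) = coxeter_elt m ` {v. conj u v}"
proof -
  have "conj_class (coxeter_group m) (coxeter_elt m u) = range (\<lambda>g. coxeter_elt m (g @ u @ rev g))"
    unfolding conj_class_def Setcompr_eq_image carrier_eq image_image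
    by (simp add: inv_elt coxeter_mult_elt)
  also have "\<dots> = coxeter_elt m ` {v. conj u v}"
  proof (intro equalityI subsetI)
    fix x assume "x \<in> range (\<lambda>g. coxeter_elt m (g @ u @ rev g))"
    then obtain g where "x = coxeter_elt m (g @ u @ rev g)" by blast
    moreover have "conj u (g @ u @ rev g)" unfolding conj_def by blast
    ultimately show "x \<in> coxeter_elt m ` {v. conj u v}" by blast
  next
    fix x assume "x \<in> coxeter_elt m ` {v. conj u v}"
    then obtain g v where "x = coxeter_elt m v" "g @ u @ rev g \<doteq> v"
      by (auto simp: conj_def)
    then have "x = coxeter_elt m (g @ u @ rev g)"
      by (simp add: coxeter_elt_eq_iff cong_sym)
    then show "x \<in> range (\<lambda>g. coxeter_elt m (g @ u @ rev g))" by blast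
  qed
  finally show ?thesis .
qed

subsection \<open>Involutions\<close>

lemma involutions_eq: "involutions (coxeter_group m) = coxeter_elt m ` {u. u @ u \<doteq> []}"
proof -
  have "coxeter_elt m u \<otimes>\<^bsub>coxeter_group m\<^esub> coxeter_elt m u = \<one>\<^bsub>coxeter_group m\<^esub> \<longleftrightarrow> u @ u \<doteq> []" for u
    by (simp add: coxeter_mult_elt coxeter_elt_eq_iff one_eq)
  then show ?thesis
    unfolding involutions_def carrier_eq by auto
qed

lemma involution_act:
  assumes "u @ u \<doteq> []"
  shows "act u (act u x) = x" and "rev u \<doteq> u"
proof -
  show "act u (act u x) = x"
    using act_cong[OF assms] by (simp add: fun_eq_iff)
  have "u @ u \<doteq> u @ rev u"
    by (rule cong_trans[OF assms cong_sym[OF append_rev_cong]])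
  then show "rev u \<doteq> u"
    unfolding cancel_left by (rule cong_sym)
qed

lemma involution_conj:
  assumes "u @ u \<doteq> []" "conj u v"
  shows "v @ v \<doteq> []"
proof -
  obtain g where "g @ u @ rev g \<doteq> v"
    using assms by (auto simp: conj_def)
  then have v: "act v = act (g @ u @ rev g)"
    by (simp only: cong_iff_act)
  show ?thesis
    unfolding cong_iff_act by (rule ext) (simp add: v involution_act(1)[OF assms(1)])
qed

text \<open>The candidate \<open>I\<close> is the set of descents of \<open>u\<close>, all negated
  by assumption. If \<open>v\<close> is longest among the words in \<open>I\<close>, then
  \<open>u @ v\<close> keeps every simple root positive, so \<open>u\<close> is the inverse of
  \<open>v\<close>.\<close>

lemma involution_without_proper_descent:
  assumes inv: "u @ u \<doteq> []"
    and desc: "\<And>s. act u (root s) \<le> 0 \<Longrightarrow> act u (root s) = - root s"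
  obtains w I where "u \<doteq> w" "set w \<subseteq> I" "acts_neg w I"
proof -
  define I where "I = {s. act u (root s) = - root s}"
  have u: "acts_neg u I" by (simp add: acts_neg_def I_def)
  define N where "N = len ` {v. set v \<subseteq> I}"
  \<comment> \<open>Since \<open>u\<close> negates the roots of \<open>I\<close>, its length bounds
    the length of every element of \<open>W_I\<close>.\<close>
  have "finite N"
    unfolding N_def by (rule finite_subset[of _ "{..len u}"]) (use acts_neg_longest(1)[OF u] in auto)
  moreover have "len [] \<in> N" unfolding N_def by (rule imageI) simp
  then have "N \<noteq> {}" by blast
  ultimately have "Max N \<in> N" by (rule Max_in)
  then obtain v where v: "set v \<subseteq> I" "len v = Max N"
    unfolding N_def image_iff by (metis mem_Collect_eq)
  have v_max: "len x \<le> len v" if "set x \<subseteq> I" for x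
    unfolding v(2) using \<open>finite N\<close> that by (auto simp: N_def)
  have "0 \<le> act (u @ v) (root s)" for s
  proof (cases "s \<in> I")
    case True
    have "\<not> 0 \<le> act v (root s)"
    proof
      assume "0 \<le> act v (root s)"
      then have "len (v @ [s]) = Suc (len v)" by (rule len_ascent)
      then show False using v_max[of "v @ [s]"] v(1) True by simp
    qed
    then have "act v (root s) \<le> 0" using act_root_sign by blast
    moreover have "act u (act v (root s)) = - act v (root s)"
      using True v(1) by (intro acts_neg_span[OF u]) (auto simp: act_nth_outside[of v I] axis_def)
    ultimately show ?thesis by simp
  next
    case False
    define z where "z = act v (root s) - root s"
    have z: "z $ i = 0" if "i \<notin> I" for i
      using act_nth_outside[OF v(1) that] by (simp add: z_def)
    have nn: "0 \<le> act u (root s)"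
      using act_root_sign[of u s] desc[of s] False by (auto simp: I_def)
    \<comment> \<open>If \<open>act u (root s)\<close> were supported on \<open>I\<close>, then
      \<open>u\<close> would negate it; as \<open>u\<close> is an involution, this forces
      \<open>act u (root s) = - root s\<close> and puts \<open>s\<close> into
      \<open>I\<close>.\<close>
    have "\<exists>i. i \<notin> I \<and> act u (root s) $ i \<noteq> 0"
    proof (rule ccontr)
      assume "\<not> ?thesis"
      then have "act u (act u (root s)) = - act u (root s)"
        by (intro acts_neg_span[OF u]) auto
      then have "act u (root s) = - root s"
        by (metis minus_minus involution_act(1)[OF inv])
      then show False using False by (simp add: I_def)
    qed
    then obtain i where i: "i \<notin> I" "act u (root s) $ i \<noteq> 0" by blast
    \<comment> \<open>The word \<open>v\<close> changes \<open>root s\<close> only by a vector in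
      the span of \<open>I\<close>, which \<open>u\<close> negates. Coordinates outside
      \<open>I\<close> are thus those of \<open>act u (root s)\<close>, and one positive coordinate
      makes a root positive.\<close>
    have "act (u @ v) (root s) = act u (root s + z)" by (simp add: z_def)
    also have "\<dots> = act u (root s) - z"
      using acts_neg_span[OF u z] by (simp add: act_linear)
    finally have "act (u @ v) (root s) $ i = act u (root s) $ i"
      by (simp add: z[OF i(1)])
    then have "act (u @ v) (root s) $ i > 0"
      using i nn by (simp add: less_eq_vec_def order_less_le)
    then show ?thesis by (rule act_root_pos_coord)
  qed
  then have "u @ v \<doteq> []" by (rule no_descent_cong_Nil)
  then have "rev u \<doteq> v" using cong_iff_rev_append[of "rev u" v] by simp
  then have uv: "u \<doteq> v" by (rule cong_trans[OF cong_sym[OF involution_act(2)[OF inv]]])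
  then have "acts_neg v I" using u act_cong[OF uv] by (simp add: acts_neg_def)
  with uv v(1) show ?thesis by (rule that)
qed

text \<open>Appending \<open>s\<close> shortens \<open>u\<close>, and prepending does so equally
  because \<open>u\<close> is its own inverse. The word \<open>s # u\<close> still has the descent
  \<open>s\<close>: the negative root \<open>act u (root s)\<close> has a nonzero coordinate away
  from \<open>s\<close>, which the reflection in \<open>s\<close> leaves unchanged.\<close>

lemma conj_descent:
  assumes inv: "u @ u \<doteq> []" and s: "act u (root s) \<le> 0" "act u (root s) \<noteq> - root s"
  shows "len (s # u @ [s]) < len u"
proof -
  define y where "y = - act u (root s)"
  have y: "0 \<le> y" using s by (simp add: y_def)
  have "\<exists>i. i \<noteq> s \<and> y $ i > 0"
  proof (rule ccontr)
    assume *: "\<not> ?thesis"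
    have "y $ i = 0" if "i \<notin> {s}" for i
      using * y that by (force simp: less_eq_vec_def order_less_le)
    then have ys: "y = y $ s *\<^sub>R root s"
      using root_expansion[of "{s}" y] by simp
    \<comment> \<open>Roots have norm 1, so a positive root proportional to \<open>root s\<close> is
      \<open>root s\<close> itself.\<close>
    have "form y y = 1"
      using form_act[of u "root s" "root s"] form_root_root[of s s] by (simp add: y_def form_linear form_commute[of "- _"])
    moreover have "form y y = y $ s * y $ s"
      using form_root_root[of s s] by (subst (1 2) ys) (simp add: form_linear form_linear_left)
    ultimately have "(y $ s)\<^sup>2 = 1" by (simp add: power2_eq_square)
    moreover have "0 \<le> y $ s" using y by (simp add: less_eq_vec_def)
    ultimately have "y $ s = 1" by (simp add: power2_eq_1_iff)
    then have "y = root s" using ys by (metis scaleR_one)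
    then show False using s(2) unfolding y_def by (metis minus_minus)
  qed
  then obtain i where i: "i \<noteq> s" "y $ i > 0" by blast
  have "act (s # u) (root s) $ i = act u (root s) $ i"
    using i(1) by (simp add: refl_nth)
  then have "act (s # u) (root s) $ i < 0"
    using i(2) by (simp add: y_def)
  then have "\<not> 0 $ i \<le> act (s # u) (root s) $ i" by simp
  then have "\<not> 0 \<le> act (s # u) (root s)" unfolding less_eq_vec_def by blast
  then have neg: "act (s # u) (root s) \<le> 0" using act_root_sign by blast
  have "Suc (len (s # u @ [s])) = len (s # u)"
    using len_descent[OF neg] by simp
  also have "len (s # u) = len (rev u @ [s])"
    using len_rev[of "s # u"] by simp
  also have "\<dots> = len (u @ [s])"
    by (intro len_cong cong_append involution_act(2)[OF inv]) simp
  finally show ?thesis using len_descent[OF s(1)] by simp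
qed

theorem richardson_involutions:
  assumes "u @ u \<doteq> []"
  obtains w I where "conj u w" "set w \<subseteq> I" "acts_neg w I"
proof -
  have "\<exists>w I. conj u w \<and> set w \<subseteq> I \<and> acts_neg w I"
    using assms
  proof (induction "len u" arbitrary: u rule: less_induct)
    case less
    show ?case
    proof (cases "\<exists>s. act u (root s) \<le> 0 \<and> act u (root s) \<noteq> - root s")
      case True
      then obtain s where "act u (root s) \<le> 0" "act u (root s) \<noteq> - root s" by blast
      then have "len (s # u @ [s]) < len u" by (rule conj_descent[OF less.prems])
      moreover have c: "conj u (s # u @ [s])"
        unfolding conj_def by (rule exI[of _ "[s]"]) simp
      ultimately obtain w I where "conj (s # u @ [s]) w" "set w \<subseteq> I" "acts_neg w I"
        using less.hyps involution_conj[OF less.prems] by blast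
      then show ?thesis using conj_trans[OF c] by blast
    next
      case False
      then show ?thesis
        using involution_without_proper_descent[OF less.prems] cong_imp_conj by metis
    qed
  qed
  then show ?thesis using that by blast
qed

section \<open>Rank two: odd bonds and commuting nodes\<close>

lemma odd_dihedral_not_acts_neg:
  assumes st: "s \<noteq> t" and odd: "odd (m s t)" and w: "set w \<subseteq> {s, t}"
  shows "\<not> acts_neg w {s, t}"
proof
  assume neg: "acts_neg w {s, t}"
  obtain k where k: "m s t = Suc k" "even k" using odd by (cases "m s t") auto
  have c: "cheb s t k = 1" using cheb_pred_m[OF st] k by simp
  \<comment> \<open>For odd \<open>m s t\<close> the longest dihedral word exchanges the two simple
    roots up to sign. Composed with \<open>w\<close>, which acts as -1, it exchanges them exactly
    and has no descent, hence is trivial: a contradiction.\<close>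
  have "act (alt s t (Suc k)) (root s) = - root t"
    using act_alt_root[OF st, of "Suc k"] k cheb_m[of s t] c by (simp add: cheb_Suc_Suc del: alt.simps)
  moreover have "act (alt s t (Suc k)) (root t) = - act (alt t s k) (root t)"
    by (simp add: refl_root_self act_linear)
  then have "act (alt s t (Suc k)) (root t) = - root s"
    using act_alt_root[OF st[symmetric], of k] k cheb_m[of s t] c by (simp add: cheb_sym[of t s] del: alt.simps)
  moreover define x where "x = w @ alt s t (Suc k)"
  ultimately have x: "act x (root s) = root t" "act x (root t) = root s"
    using neg by (simp_all add: acts_neg_def act_linear del: alt.simps)
  have "set x \<subseteq> {s, t}" using w set_alt[of s t "Suc k"] by (auto simp: x_def)
  then have out: "0 \<le> act x (root r)" if "r \<notin> {s, t}" for r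
    using that act_nth_outside[of x "{s, t}" r "root r"] by (intro act_root_pos_coord[of x r r]) simp
  have "0 \<le> root a" for a by (simp add: less_eq_vec_def axis_def)
  then have "x \<doteq> []"
    using out x by (intro no_descent_cong_Nil) (metis insertE singletonD)
  then show False using act_cong[of x "[]"] x(1) st by (simp add: axis_eq_axis)
qed

text \<open>The longest dihedral word maps \<open>root s\<close> to \<open>- root t\<close>. The
  restriction on the letters of \<open>g\<close> serves the conjugacy of pairs: \<open>g\<close>
  then commutes with any node that commutes with both \<open>s\<close> and \<open>t\<close>.\<close>

lemma odd_bond_conj:
  assumes "odd (m s t)"
  obtains g where "set g \<subseteq> {s, t}" "g @ [s] @ rev g \<doteq> [t]"
proof (cases "s = t")
  case True
  then show ?thesis using that[of "[]"] by simp
next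
  case False
  obtain k where k: "m s t = Suc k" "even k" using assms by (cases "m s t") auto
  have c: "cheb s t k = 1" using cheb_pred_m[OF False] k by simp
  have "act (alt s t (Suc k)) (root s) = - root t"
    using act_alt_root[OF False, of "Suc k"] k cheb_m[of s t] c by (simp add: cheb_Suc_Suc del: alt.simps)
  then have "alt s t (Suc k) @ [s] @ rev (alt s t (Suc k)) \<doteq> [t]"
    by (intro conj_generator) blast
  then show ?thesis using that set_alt by blast
qed

lemma commuting_letters: "m s t = 2 \<Longrightarrow> [s, t] \<doteq> [t, s]"
proof -
  assume "m s t = 2"
  then have "[s, t, s, t] \<doteq> []" using coxeter_cong.relator[of m s t] by (simp add: numeral_2_eq_2)
  then show ?thesis using cong_iff_rev_append[of "[t, s]" "[s, t]"] cong_sym by simp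
qed

lemma commuting_word:
  "(\<And>a. a \<in> set g \<Longrightarrow> m a s = 2) \<Longrightarrow> g @ [s] \<doteq> s # g"
proof (induction g)
  case (Cons a g)
  have "[a] @ (g @ [s]) \<doteq> [a] @ (s # g)"
    using Cons by (intro cong_append) auto
  also have "\<dots> = [a, s] @ g" by simp
  also have "\<dots> \<doteq> [s, a] @ g"
    using Cons.prems by (intro cong_append commuting_letters) auto
  finally show ?case by simp
qed simp

lemma odd_bond_conj_pair:
  assumes "odd (m s t)" "m s r = 2" "m t r = 2"
  shows "conj [r, s] [r, t]"
proof -
  obtain g where g: "set g \<subseteq> {s, t}" "g @ [s] @ rev g \<doteq> [t]"
    using odd_bond_conj[OF assms(1)] .
  have "(g @ [r]) @ [s] @ rev g \<doteq> (r # g) @ [s] @ rev g"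
    using g(1) assms by (intro cong_append commuting_word) auto
  also have "\<dots> = [r] @ (g @ [s] @ rev g)" by simp
  also have "\<dots> \<doteq> [r] @ [t]" using g(2) by (intro cong_append) auto
  finally show ?thesis unfolding conj_def by (intro exI[of _ g]) simp
qed

lemma acts_neg_Nil: "acts_neg [] {}"
  by (simp add: acts_neg_def)

lemma acts_neg_single: "acts_neg [s] {s}"
  by (simp add: acts_neg_def refl_root_self)

lemma acts_neg_pair: "m s t = 2 \<Longrightarrow> acts_neg [s, t] {s, t}"
proof -
  assume "m s t = 2"
  then have "refl s (root t) = root t" "refl t (root s) = root s"
    by (simp_all add: refl_root m_sym[of t s])
  then show ?thesis
    using linear_neg[OF linear_refl, of s "root t"] by (auto simp: acts_neg_def refl_root_self)
qed

text \<open>The inverse negates the same roots, and the negating element of \<open>W_I\<close> is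
  unique.\<close>

lemma acts_neg_involution:
  assumes "acts_neg w I" "set w \<subseteq> I"
  shows "w @ w \<doteq> []"
proof -
  have "w \<doteq> rev w"
    using assms by (intro acts_neg_unique[of _ I] acts_neg_rev) auto
  then have "w @ w \<doteq> w @ rev w" by (simp only: cancel_left)
  also have "\<dots> \<doteq> []" by (rule append_rev_cong)
  finally show ?thesis .
qed

subsection \<open>The character of the reflection representation\<close>

definition tr :: "'s list \<Rightarrow> real" where
  "tr u = (\<Sum>i\<in>UNIV. act u (root i) $ i)"

lemma tr_cong: "u \<doteq> v \<Longrightarrow> tr u = tr v"
  by (simp add: tr_def act_cong)

lemma tr_append: "tr (u @ v) = (\<Sum>i\<in>UNIV. \<Sum>j\<in>UNIV. act v (root i) $ j * act u (root j) $ i)"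
  unfolding tr_def
proof (intro sum.cong HOL.refl)
  fix i
  have e: "act v (root i) = (\<Sum>j\<in>UNIV. act v (root i) $ j *\<^sub>R root j)"
    by (rule root_expansion) simp
  have "act (u @ v) (root i) = act u (\<Sum>j\<in>UNIV. act v (root i) $ j *\<^sub>R root j)"
    unfolding act_append by (rule arg_cong[OF e])
  also have "\<dots> = (\<Sum>j\<in>UNIV. act v (root i) $ j *\<^sub>R act u (root j))"
    by (simp add: linear_sum[OF linear_act] act_linear)
  finally show "act (u @ v) (root i) $ i = (\<Sum>j\<in>UNIV. act v (root i) $ j * act u (root j) $ i)"
    by (simp add: sum_component)
qed

lemma tr_conj:
  assumes "conj u v"
  shows "tr u = tr v"
proof -
  obtain g where "g @ u @ rev g \<doteq> v" using assms by (auto simp: conj_def)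
  then have "tr v = tr (g @ (u @ rev g))" by (simp add: tr_cong)
  also have "\<dots> = tr ((u @ rev g) @ g)"
    unfolding tr_append[of g] tr_append[of "u @ rev g"] by (subst sum.swap) (simp only: mult.commute)
  also have "\<dots> = tr u" by (simp add: tr_def)
  finally show ?thesis by simp
qed

text \<open>Letters in \<open>I\<close> change only coordinates in \<open>I\<close>, so the matrix
  is block triangular with diagonal entries -1 on \<open>I\<close> and 1 outside.\<close>

lemma tr_acts_neg:
  assumes "set w \<subseteq> I" "acts_neg w I"
  shows "tr w = real CARD('s) - 2 * real (card I)"
proof -
  have "tr w = (\<Sum>i\<in>UNIV. if i \<in> I then -1 else 1)"
    unfolding tr_def
    using assms(2) act_nth_outside[OF assms(1)] by (intro sum.cong) (auto simp: acts_neg_def)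
  also have "\<dots> = (\<Sum>i\<in>UNIV. 1 - 2 * of_bool (i \<in> I))"
    by (intro sum.cong) auto
  finally show ?thesis by (simp add: sum_subtractf sum_distrib_left[symmetric])
qed

end

section \<open>The group of type \<open>H\<^sub>4\<close>\<close>

interpretation H4: coxeter H4_matrix
proof
  show "coxeter_matrix H4_matrix" by (rule coxeter_matrix_H4)
qed (simp add: H4_matrix_def)

lemma H4_matrix_values:
  "H4_matrix 1 2 = 5" "H4_matrix 2 1 = 5" "H4_matrix 1 3 = 2" "H4_matrix 3 1 = 2"
  "H4_matrix 1 4 = 2" "H4_matrix 4 1 = 2" "H4_matrix 2 3 = 3" "H4_matrix 3 2 = 3"
  "H4_matrix 2 4 = 2" "H4_matrix 4 2 = 2" "H4_matrix 3 4 = 3" "H4_matrix 4 3 = 3"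
  by (simp_all add: H4_matrix_def doubleton_eq_iff)

section \<open>The reflections of H4 in coordinates over Z[phi]\<close>

definition phi :: real where "phi = 2 * cos (pi / 5)"

text \<open>The equality of the sines of \<open>4 * pi / 5\<close> and \<open>pi / 5\<close> says
  that \<open>cheb 1 2 4 = 1\<close>, that is, \<open>phi^3 - 2 * phi - 1 = 0\<close>. Positivity
  excludes the factor \<open>phi + 1\<close> and leaves the equation of the golden ratio.\<close>

lemma phi_square: "phi * phi = phi + 1"
proof -
  have "(1::4) \<noteq> 2" by simp
  note c = H4.cheb_1[OF this] H4.cheb_pred_m[OF this] H4.cheb_Suc_Suc[of 1 2]
  have "H4.cheb 1 2 (Suc (Suc 0)) = phi"
    using c by (simp add: phi_def H4_matrix_values)
  moreover from this have "H4.cheb 1 2 (Suc (Suc (Suc 0))) = phi * phi - 1"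
    using c by (simp add: phi_def H4_matrix_values)
  ultimately have "phi * (phi * phi - 1) - phi = 1"
    using c(2) H4.cheb_Suc_Suc[of 1 2 "Suc (Suc 0)"]
    by (simp add: phi_def H4_matrix_values eval_nat_numeral)
  then have "(phi + 1) * (phi * phi - phi - 1) = 0"
    by (simp add: algebra_simps)
  moreover have "phi > 0"
    unfolding phi_def by (simp add: cos_gt_zero)
  ultimately show ?thesis by simp
qed

text \<open>Each coordinate is a pair of coefficients with respect to 1 and \<open>phi\<close>. The
  reflections act on these with integer coefficients, so powers of Coxeter elements can be evaluated
  by rewriting.\<close>

definition zvec :: "real \<Rightarrow> real \<Rightarrow> real \<Rightarrow> real \<Rightarrow> real \<Rightarrow> real \<Rightarrow> real \<Rightarrow> real \<Rightarrow> real ^ 4" where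
  "zvec a b c d e f g h = (\<chi> i. if i = 1 then a + b * phi else if i = 2 then c + d * phi
     else if i = 3 then e + f * phi else g + h * phi)"

lemma zvec_nth [simp]:
  "zvec a b c d e f g h $ 1 = a + b * phi" "zvec a b c d e f g h $ 2 = c + d * phi"
  "zvec a b c d e f g h $ 3 = e + f * phi" "zvec a b c d e f g h $ 4 = g + h * phi"
  by (simp_all add: zvec_def)

lemma zvec_eqI:
  "x $ 1 = a + b * phi \<Longrightarrow> x $ 2 = c + d * phi \<Longrightarrow> x $ 3 = e + f * phi \<Longrightarrow> x $ 4 = g + h * phi
    \<Longrightarrow> x = zvec a b c d e f g h"
  unfolding vec_eq_iff forall_4 zvec_nth by blast

lemma H4_refl_nth:
  "simple_reflection H4_matrix 1 x $ 1 = phi * x $ 2 - x $ 1"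
  "simple_reflection H4_matrix 2 x $ 2 = phi * x $ 1 + x $ 3 - x $ 2"
  "simple_reflection H4_matrix 3 x $ 3 = x $ 2 + x $ 4 - x $ 3"
  "simple_reflection H4_matrix 4 x $ 4 = x $ 3 - x $ 4"
  by (simp_all add: H4.refl_def H4.form_root sum_4 H4_matrix_values phi_def cos_60)

lemma H4_refl_zvec:
  "simple_reflection H4_matrix 1 (zvec a b c d e f g h) = zvec (d - a) (c + d - b) c d e f g h"
  "simple_reflection H4_matrix 2 (zvec a b c d e f g h) = zvec a b (b + e - c) (a + b + f - d) e f g h"
  "simple_reflection H4_matrix 3 (zvec a b c d e f g h) = zvec a b c d (c + g - e) (d + h - f) g h"
  "simple_reflection H4_matrix 4 (zvec a b c d e f g h) = zvec a b c d e f (e - g) (f - h)"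
proof -
  \<comment> \<open>Multiplication by \<open>phi\<close> on coefficient pairs.\<close>
  have *: "phi * (a + b * phi) = b + (a + b) * phi" for a b
    using phi_square by (simp add: algebra_simps) (metis mult.left_commute distrib_left mult.commute mult.right_neutral)
  show "simple_reflection H4_matrix 1 (zvec a b c d e f g h) = zvec (d - a) (c + d - b) c d e f g h"
    by (rule zvec_eqI) (simp_all add: H4_refl_nth H4.refl_nth *, simp_all add: algebra_simps)
  show "simple_reflection H4_matrix 2 (zvec a b c d e f g h) = zvec a b (b + e - c) (a + b + f - d) e f g h"
    by (rule zvec_eqI) (simp_all add: H4_refl_nth H4.refl_nth *, simp_all add: algebra_simps)
  show "simple_reflection H4_matrix 3 (zvec a b c d e f g h) = zvec a b c d (c + g - e) (d + h - f) g h"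
    by (rule zvec_eqI) (simp_all add: H4_refl_nth H4.refl_nth, simp_all add: algebra_simps)
  show "simple_reflection H4_matrix 4 (zvec a b c d e f g h) = zvec a b c d e f (e - g) (f - h)"
    by (rule zvec_eqI) (simp_all add: H4_refl_nth H4.refl_nth, simp_all add: algebra_simps)
qed

lemma root_zvec:
  "axis 1 1 = zvec 1 0 0 0 0 0 0 0" "axis 2 1 = zvec 0 0 1 0 0 0 0 0"
  "axis 3 1 = zvec 0 0 0 0 1 0 0 0" "axis 4 1 = zvec 0 0 0 0 0 0 1 0"
  by (rule zvec_eqI; simp add: axis_def)+

lemma zvec_uminus: "- zvec a b c d e f g h = zvec (-a) (-b) (-c) (-d) (-e) (-f) (-g) (-h)"
  by (rule zvec_eqI) simp_all

lemma foldr_concat_replicate: "foldr f (concat (replicate n xs)) = foldr f xs ^^ n"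
  by (induction n) simp_all

text \<open>Powers of Coxeter elements, of exponent half the Coxeter number (\<open>10\<close> for \<open>H\<^sub>3\<close>, \<open>30\<close> for
  \<open>H\<^sub>4\<close>).\<close>

definition w123 :: "4 list" where "w123 = concat (replicate 5 [1, 2, 3])"
definition w1234 :: "4 list" where "w1234 = concat (replicate 15 [1, 2, 3, 4])"

lemma acts_neg_w123: "H4.acts_neg w123 {1, 2, 3}"
proof -
  define c where "c = foldr (simple_reflection H4_matrix) [1, 2, 3]"
  have w: "foldr (simple_reflection H4_matrix) w123 = c ^^ 5"
    unfolding w123_def c_def by (rule foldr_concat_replicate)
  \<comment> \<open>A closed form for one Coxeter element, to be iterated on each simple
    root.\<close>
  have c: "c (zvec a b c' d e f g h) =
      zvec (b + h - f) (a + b + g + h - e - f) (b + g - e) (a + b + h - f) (c' + g - e) (d + h - f) g h"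
    for a b c' d e f g h
    by (simp add: c_def H4_refl_zvec algebra_simps)
  show ?thesis
    unfolding H4.acts_neg_def w by (simp add: root_zvec zvec_uminus numeral_eq_Suc c)
qed

lemma acts_neg_w1234: "H4.acts_neg w1234 UNIV"
proof -
  define c where "c = foldr (simple_reflection H4_matrix) [1, 2, 3, 4]"
  have w: "foldr (simple_reflection H4_matrix) w1234 = c ^^ 15"
    unfolding w1234_def c_def by (rule foldr_concat_replicate)
  have c: "c (zvec a b c' d e f g h) =
      zvec (b - h) (a + b - g - h) (b - g) (a + b - h) (c' - g) (d - h) (e - g) (f - h)"
    for a b c' d e f g h
    by (simp add: c_def H4_refl_zvec algebra_simps)
  show ?thesis
    unfolding H4.acts_neg_def w UNIV_4 by (simp add: root_zvec zvec_uminus numeral_eq_Suc c)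
qed

lemma act_w1234: "foldr (simple_reflection H4_matrix) w1234 x = - x"
  by (rule H4.acts_neg_span[OF acts_neg_w1234]) simp

section \<open>Conjugacy of simple reflections and of commuting pairs\<close>

lemma H4_conj_single: "H4.conj [s] [1]"
proof -
  have step: "H4.conj [s] [t]" if "odd (H4_matrix s t)" for s t
    using H4.odd_bond_conj[OF that] unfolding H4.conj_def by metis
  have "H4.conj [2] [1]" "H4.conj [3] [2]" "H4.conj [4] [3]"
    by (intro step; simp add: H4_matrix_values)+
  then have "\<forall>s. H4.conj [s] [1]"
    unfolding forall_4 using H4.conj_trans H4.cong_imp_conj[OF coxeter_cong.refl] by blast
  then show ?thesis ..
qed

lemma H4_commuting_pairs:
  assumes "H4_matrix s t = 2"
  shows "{s, t} = {1, 3} \<or> {s, t} = {1, 4} \<or> {s, t} = {2, 4}"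
  using assms exhaust_4[of s] exhaust_4[of t] by (auto simp: H4_matrix_values)

lemma H4_conj_14_13: "H4.conj [1, 4] [1, 3]"
  by (rule H4.odd_bond_conj_pair) (simp_all add: H4_matrix_values)

text \<open>Node 4 is held while 2 moves to 1 along the bond of label 5; then 1 is held while 4
  moves to 3. The swaps put the held letter first.\<close>

lemma H4_conj_24_13: "H4.conj [2, 4] [1, 3]"
proof -
  have "H4.conj [2, 4] [4, 2]"
    by (intro H4.cong_imp_conj H4.commuting_letters) (simp add: H4_matrix_values)
  also have "H4.conj [4, 2] [4, 1]"
    by (rule H4.odd_bond_conj_pair) (simp_all add: H4_matrix_values)
  also have "H4.conj [4, 1] [1, 4]"
    by (intro H4.cong_imp_conj H4.commuting_letters) (simp add: H4_matrix_values)
  also have "H4.conj [1, 4] [1, 3]" by (rule H4_conj_14_13)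
  finally show ?thesis .
qed

lemma H4_conj_pair:
  assumes w: "set w \<subseteq> I" "H4.acts_neg w I" and I: "card I = 2"
  shows "H4.conj w [1, 3]"
proof -
  obtain s t where st: "I = {s, t}" "s \<noteq> t" using I by (auto simp: card_2_iff)
  then have "even (H4_matrix s t)"
    using H4.odd_dihedral_not_acts_neg[of s t w] w by blast
  \<comment> \<open>The only even label in H4 is 2.\<close>
  then have 2: "H4_matrix s t = 2"
    using st(2) by (simp add: H4_matrix_def split: if_splits)
  have *: "H4.conj w [a, b]" if "I = {a, b}" "H4_matrix a b = 2" for a b
    using w that H4.acts_neg_pair[OF that(2)] by (intro H4.cong_imp_conj H4.acts_neg_unique[of w I]) auto
  show ?thesis
    using H4_commuting_pairs[OF 2] *[of 1 3] *[of 1 4] *[of 2 4] st(1)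
      H4.conj_trans[OF _ H4_conj_14_13] H4.conj_trans[OF _ H4_conj_24_13]
    by (auto simp: H4_matrix_values)
qed

section \<open>Multiplication by the central element -1\<close>

lemma central_involution:
  assumes "coxeter_cong H4_matrix (u @ u) []"
  shows "coxeter_cong H4_matrix ((w1234 @ u) @ (w1234 @ u)) []"
  unfolding H4.cong_iff_act
  by (rule ext) (simp add: act_w1234 H4.act_linear H4.involution_act(1)[OF assms])

lemma tr_central: "H4.tr (w1234 @ u) = - H4.tr u"
  by (simp add: H4.tr_def act_w1234 sum_negf)

lemma central_central: "coxeter_cong H4_matrix (w1234 @ w1234 @ u) u"
  unfolding H4.cong_iff_act by (rule ext) (simp add: act_w1234)

lemma central_commute: "coxeter_cong H4_matrix (w1234 @ u) (u @ w1234)"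
  unfolding H4.cong_iff_act by (rule ext) (simp add: act_w1234 H4.act_linear)

text \<open>The central factor can be pulled out in front of the conjugator and cancelled.\<close>

lemma conj_central:
  assumes "H4.conj (w1234 @ u) (w1234 @ v)"
  shows "H4.conj u v"
proof -
  obtain g where g: "coxeter_cong H4_matrix (g @ (w1234 @ u) @ rev g) (w1234 @ v)"
    using assms by (auto simp: H4.conj_def)
  have "coxeter_cong H4_matrix (w1234 @ g @ u @ rev g) ((g @ w1234) @ u @ rev g)"
    using H4.cong_append[OF central_commute coxeter_cong.refl, of g "u @ rev g"] by simp
  also have "(g @ w1234) @ u @ rev g = g @ (w1234 @ u) @ rev g" by simp
  also note g
  finally have "coxeter_cong H4_matrix (g @ u @ rev g) v" by (simp only: H4.cancel_left)
  then show ?thesis unfolding H4.conj_def by blast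
qed

section \<open>The trace classifies the involutions of H4\<close>

lemma involution_canonical:
  assumes "coxeter_cong H4_matrix (u @ u) []"
  obtains w I where "H4.conj u w" "set w \<subseteq> I" "H4.acts_neg w I"
    "H4.tr u = 4 - 2 * real (card I)" "card I \<le> 4"
proof -
  obtain w I where *: "H4.conj u w" "set w \<subseteq> I" "H4.acts_neg w I"
    using H4.richardson_involutions[OF assms] .
  moreover have "H4.tr u = 4 - 2 * real (card I)"
    using H4.tr_conj[OF *(1)] H4.tr_acts_neg[OF *(2,3)] by simp
  moreover have "card I \<le> 4" using card_mono[of UNIV I] by simp
  ultimately show ?thesis by (rule that)
qed

lemma involution_tr_2:
  assumes "coxeter_cong H4_matrix (u @ u) []" "H4.tr u = 2"
  shows "H4.conj u [1]"
proof -
  obtain w I where w: "H4.conj u w" "set w \<subseteq> I" "H4.acts_neg w I" "H4.tr u = 4 - 2 * real (card I)"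
    using involution_canonical[OF assms(1)] .
  then have "card I = 1" using assms(2) by simp
  then obtain s where s: "I = {s}" by (rule card_1_singletonE)
  have "H4.conj w [s]"
    using w s H4.acts_neg_single[of s] by (intro H4.cong_imp_conj H4.acts_neg_unique[of w I]) auto
  then show ?thesis
    using w(1) H4_conj_single[of s] H4.conj_trans by blast
qed

lemma involutions_same_tr_conj:
  assumes u: "coxeter_cong H4_matrix (u @ u) []" and v: "coxeter_cong H4_matrix (v @ v) []"
    and eq: "H4.tr u = H4.tr v"
  shows "H4.conj u v"
proof -
  obtain w I where w: "H4.conj u w" "set w \<subseteq> I" "H4.acts_neg w I" "H4.tr u = 4 - 2 * real (card I)" "card I \<le> 4"
    using involution_canonical[OF u] .
  obtain x J where x: "H4.conj v x" "set x \<subseteq> J" "H4.acts_neg x J" "H4.tr v = 4 - 2 * real (card J)" "card J \<le> 4"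
    using involution_canonical[OF v] .
  have card: "card J = card I" using eq w x by simp
  consider "card I = 0" | "card I = 1" | "card I = 2" | "card I = 3" | "card I = 4"
    using w(5) by linarith
  then show ?thesis
  proof cases
    case 2
    then have "H4.conj u [1]" "H4.conj v [1]"
      using w(4) x(4) card by (auto intro: involution_tr_2 u v)
    then show ?thesis using H4.conj_trans H4.conj_sym by blast
  next
    case 3
    then have "H4.conj w [1, 3]" "H4.conj x [1, 3]"
      using w x card by (auto intro: H4_conj_pair)
    then show ?thesis using w(1) x(1) H4.conj_trans H4.conj_sym by blast
  next
    case 4
    then have "H4.tr (w1234 @ u) = 2" "H4.tr (w1234 @ v) = 2"
      using w(4) x(4) card by (simp_all add: tr_central)
    then have "H4.conj (w1234 @ u) [1]" "H4.conj (w1234 @ v) [1]"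
      using central_involution[OF u] central_involution[OF v] involution_tr_2 by blast+
    then have "H4.conj (w1234 @ u) (w1234 @ v)" using H4.conj_trans H4.conj_sym by blast
    then show ?thesis by (rule conj_central)
  next
    \<comment> \<open>Sizes 0 and 4 leave a single choice of \<open>I\<close>, so both canonical
      forms are the unique negating element of the same \<open>W_I\<close>.\<close>
    case 1
    then have "I = J" using card by simp
    then have "coxeter_cong H4_matrix w x"
      using w x by (intro H4.acts_neg_unique[of w I]) auto
    then show ?thesis using w(1) x(1) H4.conj_trans H4.conj_sym H4.cong_imp_conj by blast
  next
    case 5
    then have "I = UNIV" "J = UNIV"
      using card card_subset_eq[of UNIV I] card_subset_eq[of UNIV J] by simp_all
    then have "coxeter_cong H4_matrix w x"
      using w x by (intro H4.acts_neg_unique[of w I]) auto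
    then show ?thesis using w(1) x(1) H4.conj_trans H4.conj_sym H4.cong_imp_conj by blast
  qed
qed

text \<open>Labelling the classes by their trace reduces equalities between classes to equalities
  between numbers.\<close>

definition inv_class :: "real \<Rightarrow> 4 list set set" where
  "inv_class t = coxeter_elt H4_matrix ` {v. coxeter_cong H4_matrix (v @ v) [] \<and> H4.tr v = t}"

lemma cl_H4_involution:
  assumes "coxeter_cong H4_matrix (u @ u) []"
  shows "cl_H4 (coxeter_elt H4_matrix u) = inv_class (H4.tr u)"
proof -
  have "H4.conj u v \<longleftrightarrow> coxeter_cong H4_matrix (v @ v) [] \<and> H4.tr v = H4.tr u" for v
    using H4.involution_conj[OF assms] H4.tr_conj involutions_same_tr_conj[OF assms] by metis
  then have "{v. H4.conj u v} = {v. coxeter_cong H4_matrix (v @ v) [] \<and> H4.tr v = H4.tr u}"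
    by (intro Collect_cong)
  then show ?thesis unfolding H4.conj_class_elt inv_class_def by (rule arg_cong)
qed

lemma cl_H4_longest:
  assumes "H4.acts_neg w I" "set w \<subseteq> I"
  shows "cl_H4 (w_H4 I) = inv_class (4 - 2 * real (card I))"
  unfolding H4.longest_elt_eq[OF assms] cl_H4_involution[OF H4.acts_neg_involution[OF assms]]
    H4.tr_acts_neg[OF assms(2,1)] by simp

lemma central_inv_class:
  "(\<lambda>x. coxeter_elt H4_matrix w1234 \<otimes>\<^bsub>W_H4\<^esub> x) ` inv_class t = inv_class (- t)"
proof (intro equalityI subsetI)
  fix x assume "x \<in> (\<lambda>x. coxeter_elt H4_matrix w1234 \<otimes>\<^bsub>W_H4\<^esub> x) ` inv_class t"
  then obtain v where "x = coxeter_elt H4_matrix (w1234 @ v)" "coxeter_cong H4_matrix (v @ v) []" "H4.tr v = t"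
    by (auto simp: inv_class_def coxeter_mult_elt)
  then show "x \<in> inv_class (- t)"
    unfolding inv_class_def using central_involution[of v] tr_central[of v] by blast
next
  fix x assume "x \<in> inv_class (- t)"
  then obtain v where v: "x = coxeter_elt H4_matrix v" "coxeter_cong H4_matrix (v @ v) []" "H4.tr v = - t"
    by (auto simp: inv_class_def)
  \<comment> \<open>As \<open>w1234\<close> is an involution, the preimage of \<open>x\<close> is
    its own product with \<open>w1234\<close>.\<close>
  have "coxeter_elt H4_matrix (w1234 @ v) \<in> inv_class t"
    unfolding inv_class_def using central_involution[OF v(2)] tr_central[of v] v(3) by force
  moreover have "x = coxeter_elt H4_matrix w1234 \<otimes>\<^bsub>W_H4\<^esub> coxeter_elt H4_matrix (w1234 @ v)"
    using central_central[of v] by (simp add: v(1) coxeter_mult_elt coxeter_elt_eq_iff H4.cong_sym)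
  ultimately show "x \<in> (\<lambda>x. coxeter_elt H4_matrix w1234 \<otimes>\<^bsub>W_H4\<^esub> x) ` inv_class t"
    by blast
qed

lemma inv_class_disjoint: "inv_class t \<inter> inv_class t' = {}" if "t \<noteq> t'"
  unfolding inv_class_def using H4.tr_cong that by (auto simp: coxeter_elt_eq_iff)

lemma inv_class_eq_iff:
  assumes "inv_class t \<noteq> {}"
  shows "inv_class t = inv_class t' \<longleftrightarrow> t = t'"
  using inv_class_disjoint[of t t'] assms by blast

theorem mainTheorem11:
  fixes w\<^sub>o :: "4 list set"
  assumes w\<^sub>o: "w\<^sub>o = w_H4 UNIV"
  shows "w\<^sub>o \<in> carrier W_H4 \<and> (\<forall>x\<in>carrier W_H4. w\<^sub>o \<otimes>\<^bsub>W_H4\<^esub> x = x \<otimes>\<^bsub>W_H4\<^esub> w\<^sub>o) \<and>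
     (reflection_rep H4_matrix w\<^sub>o = (\<lambda>v. - v)) \<and>
     cl_H4 ` involutions W_H4 =
           {cl_H4 (w_H4 {}), cl_H4 (w_H4 {1, 2, 3, 4}), cl_H4 (w_H4 {1}),
            cl_H4 (w_H4 {1, 2, 3}), cl_H4 (w_H4 {1, 3})} \<and>
     distinct [cl_H4 (w_H4 {}), cl_H4 (w_H4 {1, 2, 3, 4}), cl_H4 (w_H4 {1}),
            cl_H4 (w_H4 {1, 2, 3}), cl_H4 (w_H4 {1, 3})] \<and>
     (cl_H4 (w_H4 {1}) = cl_H4 (w_H4 {2})) \<and>
     (cl_H4 (w_H4 {1, 3}) = cl_H4 (w_H4 {1, 4})) \<and>
     ((\<lambda>x. w\<^sub>o \<otimes>\<^bsub>W_H4\<^esub> x) ` cl_H4 (w_H4 {}) = cl_H4 (w_H4 {1, 2, 3, 4})) \<and>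
     ((\<lambda>x. w\<^sub>o \<otimes>\<^bsub>W_H4\<^esub> x) ` cl_H4 (w_H4 {1, 2, 3, 4}) = cl_H4 (w_H4 {})) \<and>
     ((\<lambda>x. w\<^sub>o \<otimes>\<^bsub>W_H4\<^esub> x) ` cl_H4 (w_H4 {1}) = cl_H4 (w_H4 {1, 2, 3})) \<and>
     ((\<lambda>x. w\<^sub>o \<otimes>\<^bsub>W_H4\<^esub> x) ` cl_H4 (w_H4 {1, 2, 3}) = cl_H4 (w_H4 {1})) \<and>
     ((\<lambda>x. w\<^sub>o \<otimes>\<^bsub>W_H4\<^esub> x) ` cl_H4 (w_H4 {1, 3}) = cl_H4 (w_H4 {1, 3}))"
proof -
  have wo: "w\<^sub>o = coxeter_elt H4_matrix w1234"
    unfolding w\<^sub>o by (rule H4.longest_elt_eq[OF acts_neg_w1234]) simp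
  have cl: "cl_H4 (w_H4 {}) = inv_class 4" "cl_H4 (w_H4 {1, 2, 3, 4}) = inv_class (-4)"
    "cl_H4 (w_H4 {1}) = inv_class 2" "cl_H4 (w_H4 {2}) = inv_class 2"
    "cl_H4 (w_H4 {1, 2, 3}) = inv_class (-2)"
    "cl_H4 (w_H4 {1, 3}) = inv_class 0" "cl_H4 (w_H4 {1, 4}) = inv_class 0"
    using cl_H4_longest[OF H4.acts_neg_Nil] cl_H4_longest[OF acts_neg_w1234, folded UNIV_4]
      cl_H4_longest[OF H4.acts_neg_single[of 1]] cl_H4_longest[OF H4.acts_neg_single[of 2]]
      cl_H4_longest[OF acts_neg_w123]
      cl_H4_longest[OF H4.acts_neg_pair[of 1 3]] cl_H4_longest[OF H4.acts_neg_pair[of 1 4]]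
    by (simp_all add: UNIV_4[symmetric] w123_def H4_matrix_values)
  \<comment> \<open>Different traces separate classes only when these are inhabited, since all empty
    sets coincide.\<close>
  have nonempty: "inv_class t \<noteq> {}" if "t \<in> {4, -4, 2, -2, 0}" for t
  proof -
    have "cl_H4 x \<noteq> {}" for x
      using group.is_monoid[OF group_W_H4] monoid.one_closed[of W_H4] by (auto simp: conj_class_def)
    then show ?thesis using that cl by (metis empty_iff insert_iff)
  qed
  have "cl_H4 ` involutions W_H4 = {inv_class 4, inv_class (-4), inv_class 2, inv_class (-2), inv_class 0}"
    (is "?L = ?R")
  proof (intro equalityI subsetI)
    fix C assume "C \<in> ?L"
    then obtain u where u: "C = cl_H4 (coxeter_elt H4_matrix u)" "coxeter_cong H4_matrix (u @ u) []"
      by (auto simp: H4.involutions_eq)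
    obtain I :: "4 set" where I: "H4.tr u = 4 - 2 * real (card I)" "card I \<le> 4"
      using involution_canonical[OF u(2)] .
    \<comment> \<open>The five possible sizes of \<open>I\<close> give the five traces.\<close>
    then have "H4.tr u \<in> {4, -4, 2, -2, 0}" by (auto simp: le_Suc_eq numeral_eq_Suc)
    then show "C \<in> ?R" unfolding u(1) cl_H4_involution[OF u(2)] by auto
  next
    fix C assume "C \<in> ?R"
    then obtain t where t: "C = inv_class t" "t \<in> {4, -4, 2, -2, 0}" by blast
    then obtain u where u: "coxeter_cong H4_matrix (u @ u) []" "H4.tr u = t"
      using nonempty[OF t(2)] by (auto simp: inv_class_def)
    then have "C = cl_H4 (coxeter_elt H4_matrix u)" by (simp add: t cl_H4_involution)
    then show "C \<in> ?L" using u by (auto simp: H4.involutions_eq)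
  qed
  moreover have "distinct [inv_class 4, inv_class (-4), inv_class 2, inv_class (-2), inv_class 0]"
    by (simp add: inv_class_eq_iff nonempty)
  moreover have "w\<^sub>o \<in> carrier W_H4"
    by (simp add: wo H4.carrier_eq)
  moreover have "\<forall>x\<in>carrier W_H4. w\<^sub>o \<otimes>\<^bsub>W_H4\<^esub> x = x \<otimes>\<^bsub>W_H4\<^esub> w\<^sub>o"
    using central_commute by (auto simp: wo H4.carrier_eq coxeter_mult_elt coxeter_elt_eq_iff)
  moreover have "reflection_rep H4_matrix w\<^sub>o = (\<lambda>v. - v)"
    unfolding wo H4.reflection_rep_elt by (rule ext) (rule act_w1234)
  ultimately show ?thesis
    unfolding cl wo using central_inv_class[of 4] central_inv_class[of "-4"] central_inv_class[of 2]
      central_inv_class[of "-2"] central_inv_class[of 0] by simp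
qed

end
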